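(* Over $\mathrm{HA}^\omega + \mathrm{BI}$, the explicitly controlled product of selection functions $\mathsf{eps}$ is $T$-definable from the explicitly controlled product of quantifiers $\mathsf{epq}$; that is, $\mathsf{epq} \geq_T \mathsf{eps}$.
   Context: Types and systems. Finite types are generated from $\mathbb{B}$ (booleans) and $\mathbb{N}$ by $X\times Y$, $X\to Y$ and $X^*$ (finite sequences). For a sequence of types $(X_i)_{i\in\mathbb{N}}$, $\Pi_i X_i$ is the type of infinite sequences whose $i$-th entry is in $X_i$, $\Pi_{i<n}X_i$ the type of finite sequences of length $n$, and $\Pi_{i\ge k}X_i$ means $\Pi_i X_{i+k}$. (This is used for readability; one may take all $X_i$ equal to one type $X$, reading $\Pi_iX_i$ as $\mathbb{N}\to X$ and finite sequence types as $X^*$.) $\mathrm{HA}^\omega$ is Heyting arithmetic in all finite types with fully extensional equality (Troelstra's E-$\mathrm{HA}^\omega$); system $T$ is its quantifier-free fragment (Gödel's primitive recursive functionals). $\mathbf{0}$ denotes the canonical zero object of each type (the zero sequence for sequence types). Notation. $*$ is concatenation (of finite sequences, elements, and a finite with an infinite sequence). For $q\colon\Pi_{i\ge n}X_i\to R$ and $x\colon X_n$, $q_x(\alpha)=q(x*\alpha)$. $J_RX = (X\to R)\to X$ (selection functions), $K_RX=(X\to R)\to R$ (quantifiers). $T$-definability. A functional is specified by a defining equation (for each choice of type parameters). $G$ is $T$-definable from $F$ over a theory $\mathcal{S}$ (written $F\ge_T G$) if for each choice of types for $G$ there are a choice of types for $F$ and a term $s$ of system $T$ such that $s(F)$ satisfies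 the defining equation of $G$, provably in $\mathcal{S}$ together with the defining equation of $F$. $\mathsf{eps}$. For $\varepsilon\colon\Pi_kJ_RX_k$, $\ell\colon R\to\mathbb{N}$, $q\colon\Pi_iX_{i+n}\to R$, the value $\mathsf{eps}^\ell_n(\varepsilon)(q)\colon\Pi_iX_{i+n}$ is specified by: $\mathsf{eps}^\ell_n(\varepsilon)(q)=\mathbf{0}$ if $\ell(q(\mathbf{0}))<n$, and otherwise $\mathsf{eps}^\ell_n(\varepsilon)(q)=c*\mathsf{eps}^\ell_{n+1}(\varepsilon)(q_c)$, where $c=\varepsilon_n(\lambda x.\,q_x(\mathsf{eps}^\ell_{n+1}(\varepsilon)(q_x)))$. $\mathsf{epq}$. For $\phi\colon\Pi_kK_RX_k$, $\ell\colon R\to\mathbb{N}$, $q\colon\Pi_iX_{i+n}\to R$, the value $\mathsf{epq}^\ell_n(\phi)(q)\colon R$ is specified by: $\mathsf{epq}^\ell_n(\phi)(q)=q(\mathbf{0})$ if $\ell(q(\mathbf{0}))<n$, and otherwise $\mathsf{epq}^\ell_n(\phi)(q)=\phi_n(\lambda x^{X_n}.\,\mathsf{epq}^\ell_{n+1}(\phi)(q_x))$. $\mathrm{BI}$ (relativised bar induction) is the scheme, for arbitrary predicates $S,P$ on finite sequences: if $S(\langle\rangle)$, and for every infinite $\alpha$ with $S([\alpha](n))$ for all $n$ there is $n$ with $P([\alpha](n))$, and for all $s$ with $S(s)$: $\forall x[S(s*x)\to P(s*x)]\to P(s)$; then $P(\langle\rangle)$. Here $[\alpha](n)=\langle\alpha(0),\dots,\alpha(n-1)\rangle$.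 *)

theory Defs
  imports Main
begin

section \<open>Finite types and terms of system T\<close>

datatype ty =
    BoolT
  | NatT
  | ProdT ty ty  (infixr "\<times>\<^sub>t" 70)
  | FunT ty ty   (infixr "\<rightarrow>\<^sub>t" 60)
  | SeqT ty

text \<open>Finite sequences are generated by the empty sequence and by adding an entry at the
  \<^emph>\<open>end\<close> (the operation s * x of bar induction), and their recursor follows this.
  Infinite sequences over X are the objects of type N -> X.\<close>

datatype const =
    TrueC | FalseC
  | CondC ty
  | ZeroC | SuccC
  | RecC ty
  | PairC ty ty | FstC ty ty | SndC ty ty
  | EmptyC ty | SnocC ty
  | SeqRecC ty ty

primrec const_type :: "const \<Rightarrow> ty" where
  "const_type TrueC = BoolT"
| "const_type FalseC = BoolT"
| "const_type (CondC \<tau>) = BoolT \<rightarrow>\<^sub>t \<tau> \<rightarrow>\<^sub>t \<tau> \<rightarrow>\<^sub>t \<tau>"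
| "const_type ZeroC = NatT"
| "const_type SuccC = NatT \<rightarrow>\<^sub>t NatT"
| "const_type (RecC \<tau>) = \<tau> \<rightarrow>\<^sub>t (NatT \<rightarrow>\<^sub>t \<tau> \<rightarrow>\<^sub>t \<tau>) \<rightarrow>\<^sub>t NatT \<rightarrow>\<^sub>t \<tau>"
| "const_type (PairC \<sigma> \<tau>) = \<sigma> \<rightarrow>\<^sub>t \<tau> \<rightarrow>\<^sub>t \<sigma> \<times>\<^sub>t \<tau>"
| "const_type (FstC \<sigma> \<tau>) = \<sigma> \<times>\<^sub>t \<tau> \<rightarrow>\<^sub>t \<sigma>"
| "const_type (SndC \<sigma> \<tau>) = \<sigma> \<times>\<^sub>t \<tau> \<rightarrow>\<^sub>t \<tau>"
| "const_type (EmptyC \<sigma>) = SeqT \<sigma>"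
| "const_type (SnocC \<sigma>) = SeqT \<sigma> \<rightarrow>\<^sub>t \<sigma> \<rightarrow>\<^sub>t SeqT \<sigma>"
| "const_type (SeqRecC \<sigma> \<tau>) =
     \<tau> \<rightarrow>\<^sub>t (SeqT \<sigma> \<rightarrow>\<^sub>t \<sigma> \<rightarrow>\<^sub>t \<tau> \<rightarrow>\<^sub>t \<tau>) \<rightarrow>\<^sub>t SeqT \<sigma> \<rightarrow>\<^sub>t \<tau>"

text \<open>Variables are de Bruijn indices; a context lists the types of the free variables, with
  the type of variable 0 at its head.\<close>

datatype tm =
    Var nat
  | Const const
  | App tm tm  (infixl "\<cdot>" 100)
  | Lam ty tm

type_synonym ctx = "ty list"

inductive has_type :: "ctx \<Rightarrow> tm \<Rightarrow> ty \<Rightarrow> bool" ("(_ \<turnstile>\<^sub>t _ : _)" [51, 51, 51] 50) where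
  ty_Var: "k < length \<Gamma> \<Longrightarrow> \<Gamma> ! k = \<tau> \<Longrightarrow> \<Gamma> \<turnstile>\<^sub>t Var k : \<tau>"
| ty_Const: "const_type c = \<tau> \<Longrightarrow> \<Gamma> \<turnstile>\<^sub>t Const c : \<tau>"
| ty_App: "\<Gamma> \<turnstile>\<^sub>t t : \<sigma> \<rightarrow>\<^sub>t \<tau> \<Longrightarrow> \<Gamma> \<turnstile>\<^sub>t u : \<sigma> \<Longrightarrow> \<Gamma> \<turnstile>\<^sub>t t \<cdot> u : \<tau>"
| ty_Lam: "\<sigma> # \<Gamma> \<turnstile>\<^sub>t t : \<tau> \<Longrightarrow> \<Gamma> \<turnstile>\<^sub>t Lam \<sigma> t : \<sigma> \<rightarrow>\<^sub>t \<tau>"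

section \<open>Formulas\<close>

datatype fm =
    Eq ty tm tm
  | Bot
  | And fm fm
  | Or fm fm
  | Imp fm fm  (infixr "\<supset>" 55)
  | All ty fm
  | Ex ty fm

primrec wf_fm :: "ctx \<Rightarrow> fm \<Rightarrow> bool" where
  "wf_fm \<Gamma> (Eq \<tau> t u) \<longleftrightarrow> \<Gamma> \<turnstile>\<^sub>t t : \<tau> \<and> \<Gamma> \<turnstile>\<^sub>t u : \<tau>"
| "wf_fm \<Gamma> Bot \<longleftrightarrow> True"
| "wf_fm \<Gamma> (And \<phi> \<psi>) \<longleftrightarrow> wf_fm \<Gamma> \<phi> \<and> wf_fm \<Gamma> \<psi>"
| "wf_fm \<Gamma> (Or \<phi> \<psi>) \<longleftrightarrow> wf_fm \<Gamma> \<phi> \<and> wf_fm \<Gamma> \<psi>"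
| "wf_fm \<Gamma> (\<phi> \<supset> \<psi>) \<longleftrightarrow> wf_fm \<Gamma> \<phi> \<and> wf_fm \<Gamma> \<psi>"
| "wf_fm \<Gamma> (All \<tau> \<phi>) \<longleftrightarrow> wf_fm (\<tau> # \<Gamma>) \<phi>"
| "wf_fm \<Gamma> (Ex \<tau> \<phi>) \<longleftrightarrow> wf_fm (\<tau> # \<Gamma>) \<phi>"

section \<open>Renaming and substitution\<close>

definition up_ren :: "(nat \<Rightarrow> nat) \<Rightarrow> nat \<Rightarrow> nat" where
  "up_ren r = case_nat 0 (\<lambda>k. Suc (r k))"

primrec ren_tm :: "(nat \<Rightarrow> nat) \<Rightarrow> tm \<Rightarrow> tm" where
  "ren_tm r (Var k) = Var (r k)"
| "ren_tm r (Const c) = Const c"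
| "ren_tm r (t \<cdot> u) = ren_tm r t \<cdot> ren_tm r u"
| "ren_tm r (Lam \<tau> t) = Lam \<tau> (ren_tm (up_ren r) t)"

primrec ren_fm :: "(nat \<Rightarrow> nat) \<Rightarrow> fm \<Rightarrow> fm" where
  "ren_fm r (Eq \<tau> t u) = Eq \<tau> (ren_tm r t) (ren_tm r u)"
| "ren_fm r Bot = Bot"
| "ren_fm r (And \<phi> \<psi>) = And (ren_fm r \<phi>) (ren_fm r \<psi>)"
| "ren_fm r (Or \<phi> \<psi>) = Or (ren_fm r \<phi>) (ren_fm r \<psi>)"
| "ren_fm r (\<phi> \<supset> \<psi>) = ren_fm r \<phi> \<supset> ren_fm r \<psi>"
| "ren_fm r (All \<tau> \<phi>) = All \<tau> (ren_fm (up_ren r) \<phi>)"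
| "ren_fm r (Ex \<tau> \<phi>) = Ex \<tau> (ren_fm (up_ren r) \<phi>)"

abbreviation lift_tm :: "tm \<Rightarrow> tm" where "lift_tm \<equiv> ren_tm Suc"
abbreviation lift_fm :: "fm \<Rightarrow> fm" where "lift_fm \<equiv> ren_fm Suc"

definition up_sub :: "(nat \<Rightarrow> tm) \<Rightarrow> nat \<Rightarrow> tm" where
  "up_sub s = case_nat (Var 0) (\<lambda>k. lift_tm (s k))"

primrec sub_tm :: "(nat \<Rightarrow> tm) \<Rightarrow> tm \<Rightarrow> tm" where
  "sub_tm s (Var k) = s k"
| "sub_tm s (Const c) = Const c"
| "sub_tm s (t \<cdot> u) = sub_tm s t \<cdot> sub_tm s u"
| "sub_tm s (Lam \<tau> t) = Lam \<tau> (sub_tm (up_sub s) t)"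

primrec sub_fm :: "(nat \<Rightarrow> tm) \<Rightarrow> fm \<Rightarrow> fm" where
  "sub_fm s (Eq \<tau> t u) = Eq \<tau> (sub_tm s t) (sub_tm s u)"
| "sub_fm s Bot = Bot"
| "sub_fm s (And \<phi> \<psi>) = And (sub_fm s \<phi>) (sub_fm s \<psi>)"
| "sub_fm s (Or \<phi> \<psi>) = Or (sub_fm s \<phi>) (sub_fm s \<psi>)"
| "sub_fm s (\<phi> \<supset> \<psi>) = sub_fm s \<phi> \<supset> sub_fm s \<psi>"
| "sub_fm s (All \<tau> \<phi>) = All \<tau> (sub_fm (up_sub s) \<phi>)"
| "sub_fm s (Ex \<tau> \<phi>) = Ex \<tau> (sub_fm (up_sub s) \<phi>)"

text \<open>If \<phi> lives in a context \<tau> # \<Gamma> and t : \<tau> in a context \<Delta> @ \<Gamma> with \<Delta> of length m, then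
  \<open>inst_fm m t \<phi>\<close> is \<phi> with t for variable 0, living in \<Delta> @ \<Gamma>.\<close>

definition inst_sub :: "nat \<Rightarrow> tm \<Rightarrow> nat \<Rightarrow> tm" where
  "inst_sub m t = case_nat t (\<lambda>k. Var (k + m))"

definition inst_tm :: "nat \<Rightarrow> tm \<Rightarrow> tm \<Rightarrow> tm" where
  "inst_tm m t = sub_tm (inst_sub m t)"

definition inst_fm :: "nat \<Rightarrow> tm \<Rightarrow> fm \<Rightarrow> fm" where
  "inst_fm m t = sub_fm (inst_sub m t)"

section \<open>Intuitionistic many-sorted predicate logic with equality\<close>

text \<open>A theory consists of axioms, each together with the context of its free variables (its
  parameters).  In \<open>T; \<Gamma>; H \<turnstile> \<phi>\<close> the set H collects the open assumptions.\<close>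

type_synonym thy = "(ctx \<times> fm) set"

inductive prv :: "thy \<Rightarrow> ctx \<Rightarrow> fm set \<Rightarrow> fm \<Rightarrow> bool"
    ("(_; _; _ \<turnstile> _)" [51, 51, 51, 51] 50) for T :: thy where
  axiom: "(\<Gamma>, \<phi>) \<in> T \<Longrightarrow> T; \<Gamma>; H \<turnstile> \<phi>"
| assm: "\<phi> \<in> H \<Longrightarrow> wf_fm \<Gamma> \<phi> \<Longrightarrow> T; \<Gamma>; H \<turnstile> \<phi>"
| BotE: "T; \<Gamma>; H \<turnstile> Bot \<Longrightarrow> wf_fm \<Gamma> \<phi> \<Longrightarrow> T; \<Gamma>; H \<turnstile> \<phi>"
| AndI: "T; \<Gamma>; H \<turnstile> \<phi> \<Longrightarrow> T; \<Gamma>; H \<turnstile> \<psi> \<Longrightarrow> T; \<Gamma>; H \<turnstile> And \<phi> \<psi>"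
| AndE1: "T; \<Gamma>; H \<turnstile> And \<phi> \<psi> \<Longrightarrow> T; \<Gamma>; H \<turnstile> \<phi>"
| AndE2: "T; \<Gamma>; H \<turnstile> And \<phi> \<psi> \<Longrightarrow> T; \<Gamma>; H \<turnstile> \<psi>"
| OrI1: "T; \<Gamma>; H \<turnstile> \<phi> \<Longrightarrow> wf_fm \<Gamma> \<psi> \<Longrightarrow> T; \<Gamma>; H \<turnstile> Or \<phi> \<psi>"
| OrI2: "T; \<Gamma>; H \<turnstile> \<psi> \<Longrightarrow> wf_fm \<Gamma> \<phi> \<Longrightarrow> T; \<Gamma>; H \<turnstile> Or \<phi> \<psi>"
| OrE: "T; \<Gamma>; H \<turnstile> Or \<phi> \<psi> \<Longrightarrow> T; \<Gamma>; insert \<phi> H \<turnstile> \<chi> \<Longrightarrow> T; \<Gamma>; insert \<psi> H \<turnstile> \<chi>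
    \<Longrightarrow> T; \<Gamma>; H \<turnstile> \<chi>"
| ImpI: "T; \<Gamma>; insert \<phi> H \<turnstile> \<psi> \<Longrightarrow> wf_fm \<Gamma> \<phi> \<Longrightarrow> T; \<Gamma>; H \<turnstile> \<phi> \<supset> \<psi>"
| ImpE: "T; \<Gamma>; H \<turnstile> \<phi> \<supset> \<psi> \<Longrightarrow> T; \<Gamma>; H \<turnstile> \<phi> \<Longrightarrow> T; \<Gamma>; H \<turnstile> \<psi>"
| AllI: "T; \<tau> # \<Gamma>; lift_fm ` H \<turnstile> \<phi> \<Longrightarrow> T; \<Gamma>; H \<turnstile> All \<tau> \<phi>"
| AllE: "T; \<Gamma>; H \<turnstile> All \<tau> \<phi> \<Longrightarrow> \<Gamma> \<turnstile>\<^sub>t t : \<tau> \<Longrightarrow> T; \<Gamma>; H \<turnstile> inst_fm 0 t \<phi>"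
| ExI: "T; \<Gamma>; H \<turnstile> inst_fm 0 t \<phi> \<Longrightarrow> \<Gamma> \<turnstile>\<^sub>t t : \<tau> \<Longrightarrow> wf_fm (\<tau> # \<Gamma>) \<phi> \<Longrightarrow> T; \<Gamma>; H \<turnstile> Ex \<tau> \<phi>"
| ExE: "T; \<Gamma>; H \<turnstile> Ex \<tau> \<phi> \<Longrightarrow> T; \<tau> # \<Gamma>; insert \<phi> (lift_fm ` H) \<turnstile> lift_fm \<psi> \<Longrightarrow> wf_fm \<Gamma> \<psi>
    \<Longrightarrow> T; \<Gamma>; H \<turnstile> \<psi>"
| EqRefl: "\<Gamma> \<turnstile>\<^sub>t t : \<tau> \<Longrightarrow> T; \<Gamma>; H \<turnstile> Eq \<tau> t t"
| EqSubst: "T; \<Gamma>; H \<turnstile> Eq \<tau> t u \<Longrightarrow> T; \<Gamma>; H \<turnstile> inst_fm 0 t \<phi> \<Longrightarrow> wf_fm (\<tau> # \<Gamma>) \<phi>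
    \<Longrightarrow> T; \<Gamma>; H \<turnstile> inst_fm 0 u \<phi>"

section \<open>Heyting arithmetic in all finite types with extensional equality\<close>

abbreviation "Zero \<equiv> Const ZeroC"
abbreviation "Succ t \<equiv> Const SuccC \<cdot> t"
abbreviation "Cond \<tau> b t u \<equiv> Const (CondC \<tau>) \<cdot> b \<cdot> t \<cdot> u"
abbreviation "Rec \<tau> a f n \<equiv> Const (RecC \<tau>) \<cdot> a \<cdot> f \<cdot> n"
abbreviation "MkPair \<sigma> \<tau> t u \<equiv> Const (PairC \<sigma> \<tau>) \<cdot> t \<cdot> u"
abbreviation "Empty \<sigma> \<equiv> Const (EmptyC \<sigma>)"
abbreviation "Snoc \<sigma> s x \<equiv> Const (SnocC \<sigma>) \<cdot> s \<cdot> x"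
abbreviation "SeqRec \<sigma> \<tau> a f s \<equiv> Const (SeqRecC \<sigma> \<tau>) \<cdot> a \<cdot> f \<cdot> s"

inductive_set HA_omega :: thy where
  beta: "\<sigma> # \<Gamma> \<turnstile>\<^sub>t t : \<tau> \<Longrightarrow> \<Gamma> \<turnstile>\<^sub>t u : \<sigma> \<Longrightarrow> (\<Gamma>, Eq \<tau> (Lam \<sigma> t \<cdot> u) (inst_tm 0 u t)) \<in> HA_omega"
| ext: "\<Gamma> \<turnstile>\<^sub>t f : \<sigma> \<rightarrow>\<^sub>t \<tau> \<Longrightarrow> \<Gamma> \<turnstile>\<^sub>t g : \<sigma> \<rightarrow>\<^sub>t \<tau> \<Longrightarrow>
    (\<Gamma>, All \<sigma> (Eq \<tau> (lift_tm f \<cdot> Var 0) (lift_tm g \<cdot> Var 0)) \<supset> Eq (\<sigma> \<rightarrow>\<^sub>t \<tau>) f g) \<in> HA_omega"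
| cond_true: "\<Gamma> \<turnstile>\<^sub>t t : \<tau> \<Longrightarrow> \<Gamma> \<turnstile>\<^sub>t u : \<tau> \<Longrightarrow>
    (\<Gamma>, Eq \<tau> (Cond \<tau> (Const TrueC) t u) t) \<in> HA_omega"
| cond_false: "\<Gamma> \<turnstile>\<^sub>t t : \<tau> \<Longrightarrow> \<Gamma> \<turnstile>\<^sub>t u : \<tau> \<Longrightarrow>
    (\<Gamma>, Eq \<tau> (Cond \<tau> (Const FalseC) t u) u) \<in> HA_omega"
| bool_ind: "wf_fm (BoolT # \<Gamma>) \<phi> \<Longrightarrow>
    (\<Gamma>, inst_fm 0 (Const TrueC) \<phi> \<supset> inst_fm 0 (Const FalseC) \<phi> \<supset> All BoolT \<phi>) \<in> HA_omega"
| succ_not_zero: "\<Gamma> \<turnstile>\<^sub>t t : NatT \<Longrightarrow> (\<Gamma>, Eq NatT (Succ t) Zero \<supset> Bot) \<in> HA_omega"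
| succ_inj: "\<Gamma> \<turnstile>\<^sub>t t : NatT \<Longrightarrow> \<Gamma> \<turnstile>\<^sub>t u : NatT \<Longrightarrow>
    (\<Gamma>, Eq NatT (Succ t) (Succ u) \<supset> Eq NatT t u) \<in> HA_omega"
| rec_zero: "\<Gamma> \<turnstile>\<^sub>t a : \<tau> \<Longrightarrow> \<Gamma> \<turnstile>\<^sub>t f : NatT \<rightarrow>\<^sub>t \<tau> \<rightarrow>\<^sub>t \<tau> \<Longrightarrow>
    (\<Gamma>, Eq \<tau> (Rec \<tau> a f Zero) a) \<in> HA_omega"
| rec_succ: "\<Gamma> \<turnstile>\<^sub>t a : \<tau> \<Longrightarrow> \<Gamma> \<turnstile>\<^sub>t f : NatT \<rightarrow>\<^sub>t \<tau> \<rightarrow>\<^sub>t \<tau> \<Longrightarrow> \<Gamma> \<turnstile>\<^sub>t n : NatT \<Longrightarrow>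
    (\<Gamma>, Eq \<tau> (Rec \<tau> a f (Succ n)) (f \<cdot> n \<cdot> Rec \<tau> a f n)) \<in> HA_omega"
| nat_ind: "wf_fm (NatT # \<Gamma>) \<phi> \<Longrightarrow>
    (\<Gamma>, inst_fm 0 Zero \<phi> \<supset> All NatT (\<phi> \<supset> inst_fm 1 (Succ (Var 0)) \<phi>) \<supset> All NatT \<phi>) \<in> HA_omega"
| fst_pair: "\<Gamma> \<turnstile>\<^sub>t t : \<sigma> \<Longrightarrow> \<Gamma> \<turnstile>\<^sub>t u : \<tau> \<Longrightarrow>
    (\<Gamma>, Eq \<sigma> (Const (FstC \<sigma> \<tau>) \<cdot> MkPair \<sigma> \<tau> t u) t) \<in> HA_omega"
| snd_pair: "\<Gamma> \<turnstile>\<^sub>t t : \<sigma> \<Longrightarrow> \<Gamma> \<turnstile>\<^sub>t u : \<tau> \<Longrightarrow>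
    (\<Gamma>, Eq \<tau> (Const (SndC \<sigma> \<tau>) \<cdot> MkPair \<sigma> \<tau> t u) u) \<in> HA_omega"
| pair_surj: "\<Gamma> \<turnstile>\<^sub>t p : \<sigma> \<times>\<^sub>t \<tau> \<Longrightarrow>
    (\<Gamma>, Eq (\<sigma> \<times>\<^sub>t \<tau>) (MkPair \<sigma> \<tau> (Const (FstC \<sigma> \<tau>) \<cdot> p) (Const (SndC \<sigma> \<tau>) \<cdot> p)) p) \<in> HA_omega"
| seqrec_empty: "\<Gamma> \<turnstile>\<^sub>t a : \<tau> \<Longrightarrow> \<Gamma> \<turnstile>\<^sub>t f : SeqT \<sigma> \<rightarrow>\<^sub>t \<sigma> \<rightarrow>\<^sub>t \<tau> \<rightarrow>\<^sub>t \<tau> \<Longrightarrow>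
    (\<Gamma>, Eq \<tau> (SeqRec \<sigma> \<tau> a f (Empty \<sigma>)) a) \<in> HA_omega"
| seqrec_snoc: "\<Gamma> \<turnstile>\<^sub>t a : \<tau> \<Longrightarrow> \<Gamma> \<turnstile>\<^sub>t f : SeqT \<sigma> \<rightarrow>\<^sub>t \<sigma> \<rightarrow>\<^sub>t \<tau> \<rightarrow>\<^sub>t \<tau> \<Longrightarrow>
    \<Gamma> \<turnstile>\<^sub>t s : SeqT \<sigma> \<Longrightarrow> \<Gamma> \<turnstile>\<^sub>t x : \<sigma> \<Longrightarrow>
    (\<Gamma>, Eq \<tau> (SeqRec \<sigma> \<tau> a f (Snoc \<sigma> s x)) (f \<cdot> s \<cdot> x \<cdot> SeqRec \<sigma> \<tau> a f s)) \<in> HA_omega"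
| seq_ind: "wf_fm (SeqT \<sigma> # \<Gamma>) \<phi> \<Longrightarrow>
    (\<Gamma>, inst_fm 0 (Empty \<sigma>) \<phi>
        \<supset> All (SeqT \<sigma>) (\<phi> \<supset> All \<sigma> (inst_fm 2 (Snoc \<sigma> (Var 1) (Var 0)) \<phi>))
        \<supset> All (SeqT \<sigma>) \<phi>) \<in> HA_omega"

section \<open>Relativised bar induction\<close>

text \<open>The closed term \<open>segment X\<close> maps \<alpha> and n to the initial segment of \<alpha> of length n.\<close>

definition segment :: "ty \<Rightarrow> tm" where
  "segment X = Lam (NatT \<rightarrow>\<^sub>t X) (Lam NatT
     (Rec (SeqT X) (Empty X) (Lam NatT (Lam (SeqT X) (Snoc X (Var 0) (Var 3 \<cdot> Var 1)))) (Var 0)))"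

inductive_set BI :: thy where
  BI: "wf_fm (SeqT X # \<Gamma>) S \<Longrightarrow> wf_fm (SeqT X # \<Gamma>) P \<Longrightarrow>
    (\<Gamma>, inst_fm 0 (Empty X) S
        \<supset> All (NatT \<rightarrow>\<^sub>t X)
            (All NatT (inst_fm 2 (segment X \<cdot> Var 1 \<cdot> Var 0) S)
              \<supset> Ex NatT (inst_fm 2 (segment X \<cdot> Var 1 \<cdot> Var 0) P))
        \<supset> All (SeqT X)
            (S \<supset> All X (inst_fm 2 (Snoc X (Var 1) (Var 0)) S
                      \<supset> inst_fm 2 (Snoc X (Var 1) (Var 0)) P)
               \<supset> P)
        \<supset> inst_fm 0 (Empty X) P) \<in> BI"

section \<open>T-definability\<close>

text \<open>A functional is specified by its type and its defining equation, both depending on type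
  parameters of type \<open>'p\<close>.  The equation is a formula in the context consisting of the type of the
  functional: variable 0 stands for the functional.\<close>

datatype 'p functional = Functional (ftype: "'p \<Rightarrow> ty") (equation: "'p \<Rightarrow> fm")

text \<open>\<open>T_definable T F G\<close>: the functional G is T-definable from F over T.  The F of
  the defining equation is variable 0 of the context of the derivation, and the witness s is a
  closed term of system T.\<close>

definition T_definable :: "thy \<Rightarrow> 'p functional \<Rightarrow> 'q functional \<Rightarrow> bool" where
  "T_definable T F G \<longleftrightarrow>
     (\<forall>q. \<exists>p s. [] \<turnstile>\<^sub>t s : ftype F p \<rightarrow>\<^sub>t ftype G q \<and>
        (T; [ftype F p]; {equation F p} \<turnstile> inst_fm 1 (s \<cdot> Var 0) (equation G q)))"

section \<open>The explicitly controlled products\<close>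

primrec zero :: "ty \<Rightarrow> tm" where
  "zero BoolT = Const FalseC"
| "zero NatT = Zero"
| "zero (\<sigma> \<times>\<^sub>t \<tau>) = MkPair \<sigma> \<tau> (zero \<sigma>) (zero \<tau>)"
| "zero (\<sigma> \<rightarrow>\<^sub>t \<tau>) = Lam \<sigma> (zero \<tau>)"
| "zero (SeqT \<sigma>) = Empty \<sigma>"

text \<open>The order on N as a closed boolean-valued term: m < n iff n - m, formed by iterating the
  predecessor, is positive.\<close>

definition pred_tm :: tm where
  "pred_tm = Lam NatT (Rec NatT Zero (Lam NatT (Lam NatT (Var 1))) (Var 0))"

definition monus_tm :: tm where
  "monus_tm = Lam NatT (Lam NatT (Rec NatT (Var 1) (Lam NatT (Lam NatT (pred_tm \<cdot> Var 0))) (Var 0)))"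

definition positive_tm :: tm where
  "positive_tm = Lam NatT (Rec BoolT (Const FalseC) (Lam NatT (Lam BoolT (Const TrueC))) (Var 0))"

definition less_tm :: tm where
  "less_tm = Lam NatT (Lam NatT (positive_tm \<cdot> (monus_tm \<cdot> Var 0 \<cdot> Var 1)))"

text \<open>The closed terms \<open>prepend X\<close>, mapping x and \<alpha> to x * \<alpha>, and \<open>section_at X R\<close>, mapping q and x
  to q_x, the function with q_x(\<alpha>) = q(x * \<alpha>).\<close>

definition prepend :: "ty \<Rightarrow> tm" where
  "prepend X = Lam X (Lam (NatT \<rightarrow>\<^sub>t X) (Lam NatT
     (Rec X (Var 2) (Lam NatT (Lam X (Var 3 \<cdot> Var 1))) (Var 0))))"

definition section_at :: "ty \<Rightarrow> ty \<Rightarrow> tm" where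
  "section_at X R = Lam ((NatT \<rightarrow>\<^sub>t X) \<rightarrow>\<^sub>t R) (Lam X (Lam (NatT \<rightarrow>\<^sub>t X)
     (Var 2 \<cdot> (prepend X \<cdot> Var 1 \<cdot> Var 0))))"

definition J :: "ty \<Rightarrow> ty \<Rightarrow> ty" where "J R X = (X \<rightarrow>\<^sub>t R) \<rightarrow>\<^sub>t X"
definition K :: "ty \<Rightarrow> ty \<Rightarrow> ty" where "K R X = (X \<rightarrow>\<^sub>t R) \<rightarrow>\<^sub>t R"

text \<open>The families of types X_0, X_1, ... are taken constant, so the type parameters are X and R,
  and all of the sequence types from position n on are N -> X.  The arguments are taken in the
  order l, n, then the selection functions or quantifiers, then q.\<close>

definition eps_type :: "ty \<Rightarrow> ty \<Rightarrow> ty" where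
  "eps_type X R = (R \<rightarrow>\<^sub>t NatT) \<rightarrow>\<^sub>t NatT \<rightarrow>\<^sub>t (NatT \<rightarrow>\<^sub>t J R X) \<rightarrow>\<^sub>t
     ((NatT \<rightarrow>\<^sub>t X) \<rightarrow>\<^sub>t R) \<rightarrow>\<^sub>t (NatT \<rightarrow>\<^sub>t X)"

definition eps_equation :: "ty \<Rightarrow> ty \<Rightarrow> fm" where
  "eps_equation X R =
     All (R \<rightarrow>\<^sub>t NatT) (All NatT (All (NatT \<rightarrow>\<^sub>t J R X) (All ((NatT \<rightarrow>\<^sub>t X) \<rightarrow>\<^sub>t R)
       (let F = Var 4; l = Var 3; n = Var 2; e = Var 1; q = Var 0;
            c = e \<cdot> n \<cdot> Lam X
                  (let F' = Var 5; l' = Var 4; n' = Var 3; e' = Var 2; q' = Var 1;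
                       qx = section_at X R \<cdot> q' \<cdot> Var 0
                   in qx \<cdot> (F' \<cdot> l' \<cdot> Succ n' \<cdot> e' \<cdot> qx))
        in Eq (NatT \<rightarrow>\<^sub>t X) (F \<cdot> l \<cdot> n \<cdot> e \<cdot> q)
             (Cond (NatT \<rightarrow>\<^sub>t X) (less_tm \<cdot> (l \<cdot> (q \<cdot> zero (NatT \<rightarrow>\<^sub>t X))) \<cdot> n)
                (zero (NatT \<rightarrow>\<^sub>t X))
                (prepend X \<cdot> c \<cdot> (F \<cdot> l \<cdot> Succ n \<cdot> e \<cdot> (section_at X R \<cdot> q \<cdot> c))))))))"

definition epq_type :: "ty \<Rightarrow> ty \<Rightarrow> ty" where
  "epq_type X R = (R \<rightarrow>\<^sub>t NatT) \<rightarrow>\<^sub>t NatT \<rightarrow>\<^sub>t (NatT \<rightarrow>\<^sub>t K R X) \<rightarrow>\<^sub>t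
     ((NatT \<rightarrow>\<^sub>t X) \<rightarrow>\<^sub>t R) \<rightarrow>\<^sub>t R"

definition epq_equation :: "ty \<Rightarrow> ty \<Rightarrow> fm" where
  "epq_equation X R =
     All (R \<rightarrow>\<^sub>t NatT) (All NatT (All (NatT \<rightarrow>\<^sub>t K R X) (All ((NatT \<rightarrow>\<^sub>t X) \<rightarrow>\<^sub>t R)
       (let F = Var 4; l = Var 3; n = Var 2; f = Var 1; q = Var 0
        in Eq R (F \<cdot> l \<cdot> n \<cdot> f \<cdot> q)
             (Cond R (less_tm \<cdot> (l \<cdot> (q \<cdot> zero (NatT \<rightarrow>\<^sub>t X))) \<cdot> n)
                (q \<cdot> zero (NatT \<rightarrow>\<^sub>t X))
                (f \<cdot> n \<cdot> Lam X
                   (let F' = Var 5; l' = Var 4; n' = Var 3; f' = Var 2; q' = Var 1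
                    in F' \<cdot> l' \<cdot> Succ n' \<cdot> f' \<cdot> (section_at X R \<cdot> q' \<cdot> Var 0))))))))"

definition eps :: "(ty \<times> ty) functional" where
  "eps = Functional (\<lambda>(X, R). eps_type X R) (\<lambda>(X, R). eps_equation X R)"

definition epq :: "(ty \<times> ty) functional" where
  "epq = Functional (\<lambda>(X, R). epq_type X R) (\<lambda>(X, R). epq_equation X R)"

end

theory Submission
  imports Defs
begin

text \<open>Let V be the product of N -> X and (N -> X) -> N -> N, and run epq with result type V, the
  control l(q(fst v)), the outcome function mapping \<alpha> to (\<alpha>, 0) and the quantifiers that map f to
  (fst (f c), _), where c = \<epsilon>_k(\<lambda>y. q(fst (f y))).  The first component of the result is the play that
  eps computes.  The equation of eps for it reduces to the identity

  fst (epq_{n+|s|} for q, from position x * s) = x * fst (epq_{n+|s|} for q_x, from position s),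

  whose two sides unfold in the same way, so that it follows by bar induction on s.  That every
  \<alpha> has an initial segment at which the recursion stops is forced by the equation of epq
  (Howard's argument): the second component counts the steps along \<alpha>, so its value g(j) at the
  segment of length j satisfies g(j) = g(j+1) + 1 as long as the recursion goes on, and an
  induction on the value of g shows that it cannot go on forever.

  Object-level equations are treated as HOL equations between classes of provably equal terms.
  All auxiliary functionals are closed combinators, so that no substitution goes under a binder.\<close>

section \<open>Substitution calculus\<close>

text \<open>The cons operation on substitutions. Both \<open>up_sub\<close> and
  \<open>inst_sub\<close> are rewritten into it, so that a small set of rewrite rules evaluates
  every substitution that occurs.\<close>

definition scons :: "tm \<Rightarrow> (nat \<Rightarrow> tm) \<Rightarrow> nat \<Rightarrow> tm" where
  "scons t s = case_nat t s"

lemma scons_simps [simp]: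
  "scons t s 0 = t" "scons t s (Suc k) = s k"
  by (simp_all add: scons_def)

lemma scons_numeral [simp]: "scons t s (numeral k) = s (pred_numeral k)"
  by (simp add: numeral_eq_Suc)

lemma up_ren_simps [simp]: "up_ren r 0 = 0" "up_ren r (Suc k) = Suc (r k)"
  by (simp_all add: up_ren_def)

lemma up_sub_scons: "up_sub s = scons (Var 0) (lift_tm \<circ> s)"
  by (auto simp: up_sub_def scons_def fun_eq_iff split: nat.split)

lemma inst_sub_scons: "inst_sub m t = scons t (\<lambda>k. Var (k + m))"
  by (simp add: inst_sub_def scons_def)

lemma up_ren_comp: "up_ren r \<circ> up_ren r' = up_ren (r \<circ> r')"
  by (auto simp: up_ren_def fun_eq_iff split: nat.split)

lemma ren_ren_tm: "ren_tm r (ren_tm r' t) = ren_tm (r \<circ> r') t"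
  by (induction t arbitrary: r r') (simp_all add: up_ren_comp)

lemma up_sub_up_ren: "up_sub s \<circ> up_ren r = up_sub (s \<circ> r)"
  by (auto simp: up_ren_def up_sub_def fun_eq_iff split: nat.split)

lemma sub_ren_tm: "sub_tm s (ren_tm r t) = sub_tm (s \<circ> r) t"
  by (induction t arbitrary: s r) (simp_all add: up_sub_up_ren)

lemma ren_up_sub: "ren_tm (up_ren r) \<circ> up_sub s = up_sub (ren_tm r \<circ> s)"
  by (auto simp: up_sub_def fun_eq_iff ren_ren_tm comp_def split: nat.split)

lemma ren_sub_tm: "ren_tm r (sub_tm s t) = sub_tm (ren_tm r \<circ> s) t"
  by (induction t arbitrary: s r) (simp_all add: ren_up_sub)

lemma sub_up_sub: "sub_tm (up_sub s) \<circ> up_sub s' = up_sub (sub_tm s \<circ> s')"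
proof
  fix k
  have "up_sub s \<circ> Suc = lift_tm \<circ> s"
    by (simp add: up_sub_scons fun_eq_iff)
  then show "(sub_tm (up_sub s) \<circ> up_sub s') k = up_sub (sub_tm s \<circ> s') k"
    by (cases k) (simp_all add: up_sub_scons sub_ren_tm ren_sub_tm)
qed

lemma sub_sub_tm: "sub_tm s (sub_tm s' t) = sub_tm (sub_tm s \<circ> s') t"
  by (induction t arbitrary: s s') (simp_all add: sub_up_sub)

lemma up_sub_Var: "up_sub Var = Var"
  by (auto simp: up_sub_def fun_eq_iff split: nat.split)

lemma sub_tm_Var [simp]: "sub_tm Var t = t"
  by (induction t) (simp_all add: up_sub_Var)

lemma sub_tm_Var_comp [simp]: "sub_tm Var \<circ> s = s"
  by (simp add: fun_eq_iff)

lemma ren_tm_sub: "ren_tm r t = sub_tm (Var \<circ> r) t"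
  using sub_ren_tm[of Var r t] by simp

lemma sub_scons_lift [simp]: "sub_tm (scons a s) (lift_tm t) = sub_tm s t"
proof -
  have "scons a s \<circ> Suc = s" by (simp add: fun_eq_iff)
  then show ?thesis by (simp add: sub_ren_tm)
qed

lemma sub_scons_comp_up: "sub_tm (scons a s') \<circ> up_sub s = scons a (sub_tm s' \<circ> s)"
proof
  show "(sub_tm (scons a s') \<circ> up_sub s) k = scons a (sub_tm s' \<circ> s) k" for k
    by (cases k) (simp_all add: up_sub_scons)
qed

lemma ren_comp_scons [simp]: "ren_tm r \<circ> scons a s = scons (ren_tm r a) (ren_tm r \<circ> s)"
  by (auto simp: scons_def fun_eq_iff split: nat.split)

lemma up_ren_lift [simp]: "ren_tm (up_ren r) (lift_tm t) = lift_tm (ren_tm r t)"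
  by (simp add: ren_ren_tm comp_def)

lemma ren_sub_fm: "ren_fm r (sub_fm s \<phi>) = sub_fm (ren_tm r \<circ> s) \<phi>"
  by (induction \<phi> arbitrary: s r) (simp_all add: ren_sub_tm ren_up_sub)

lemma ren_ren_fm: "ren_fm r (ren_fm r' \<phi>) = ren_fm (r \<circ> r') \<phi>"
  by (induction \<phi> arbitrary: r r') (simp_all add: ren_ren_tm up_ren_comp)

lemma up_ren_lift_fm [simp]: "ren_fm (up_ren r) (lift_fm \<phi>) = lift_fm (ren_fm r \<phi>)"
  by (simp add: ren_ren_fm comp_def)

lemma sub_ren_fm: "sub_fm s (ren_fm r \<phi>) = sub_fm (s \<circ> r) \<phi>"
  by (induction \<phi> arbitrary: s r) (simp_all add: sub_ren_tm up_sub_up_ren)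

lemma sub_sub_fm: "sub_fm s (sub_fm s' \<phi>) = sub_fm (sub_tm s \<circ> s') \<phi>"
  by (induction \<phi> arbitrary: s s') (simp_all add: sub_sub_tm sub_up_sub)

lemma sub_fm_Var [simp]: "sub_fm Var \<phi> = \<phi>"
  by (induction \<phi>) (simp_all add: up_sub_Var)

lemma sub_scons_lift_fm [simp]: "sub_fm (scons a s) (lift_fm \<phi>) = sub_fm s \<phi>"
proof -
  have "scons a s \<circ> Suc = s" by (simp add: fun_eq_iff)
  then show ?thesis by (simp add: sub_ren_fm)
qed

lemma sub_scons_up_fm: "sub_fm (scons a Var) (sub_fm (up_sub s) \<phi>) = sub_fm (scons a s) \<phi>"
  by (simp add: sub_sub_fm sub_scons_comp_up)

text \<open>Oriented so that a renaming common to all entries of a substitution is pulled out. The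
  shifts that \<open>up_sub\<close> introduces then stand outside as \<open>lift_tm\<close>, where
  \<open>sub_scons_lift\<close> can cancel them.\<close>

lemmas sub_ren_comp [simp] = ren_sub_tm[symmetric] ren_sub_fm[symmetric]

section \<open>Type inference\<close>

fun app_ty :: "ty option \<Rightarrow> ty option \<Rightarrow> ty option" where
  "app_ty (Some (\<sigma> \<rightarrow>\<^sub>t \<tau>)) (Some \<sigma>') = (if \<sigma> = \<sigma>' then Some \<tau> else None)"
| "app_ty _ _ = None"

lemma app_ty_eq_Some_iff:
  "app_ty A B = Some \<tau> \<longleftrightarrow> (\<exists>\<sigma>. A = Some (\<sigma> \<rightarrow>\<^sub>t \<tau>) \<and> B = Some \<sigma>)"
  by (cases "(A, B)" rule: app_ty.cases) auto

text \<open>Terms carry the types of their bound variables, so typing is a computation. As a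
  function it lets the simplifier decide typing conditions by evaluation.\<close>

primrec tyof :: "ctx \<Rightarrow> tm \<Rightarrow> ty option" where
  "tyof \<Gamma> (Var k) = (if k < length \<Gamma> then Some (\<Gamma> ! k) else None)"
| "tyof \<Gamma> (Const c) = Some (const_type c)"
| "tyof \<Gamma> (t \<cdot> u) = app_ty (tyof \<Gamma> t) (tyof \<Gamma> u)"
| "tyof \<Gamma> (Lam \<sigma> t) = map_option (FunT \<sigma>) (tyof (\<sigma> # \<Gamma>) t)"

lemma has_type_iff: "\<Gamma> \<turnstile>\<^sub>t t : \<tau> \<longleftrightarrow> tyof \<Gamma> t = Some \<tau>"
proof
  show "\<Gamma> \<turnstile>\<^sub>t t : \<tau> \<Longrightarrow> tyof \<Gamma> t = Some \<tau>"
    by (induction rule: has_type.induct) auto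
  show "tyof \<Gamma> t = Some \<tau> \<Longrightarrow> \<Gamma> \<turnstile>\<^sub>t t : \<tau>"
  proof (induction t arbitrary: \<Gamma> \<tau>)
    case (App t u)
    then show ?case by (metis app_ty_eq_Some_iff tyof.simps(3) ty_App)
  qed (auto split: if_splits intro: has_type.intros)
qed

text \<open>The equivalence in the first assumption keeps untypable terms untypable. The conclusion
  is therefore an equation of options and gives the rewrite rule \<open>tyof_lift\<close>.\<close>

lemma tyof_ren:
  assumes "\<And>k. r k < length \<Delta> \<longleftrightarrow> k < length \<Gamma>" "\<And>k. k < length \<Gamma> \<Longrightarrow> \<Delta> ! r k = \<Gamma> ! k"
  shows "tyof \<Delta> (ren_tm r t) = tyof \<Gamma> t"
  using assms
proof (induction t arbitrary: \<Gamma> \<Delta> r)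
  case (Lam \<sigma> t)
  have "tyof (\<sigma> # \<Delta>) (ren_tm (up_ren r) t) = tyof (\<sigma> # \<Gamma>) t"
  proof (rule Lam.IH)
    show "up_ren r k < length (\<sigma> # \<Delta>) \<longleftrightarrow> k < length (\<sigma> # \<Gamma>)" for k
      using Lam.prems(1) by (cases k) auto
    show "k < length (\<sigma> # \<Gamma>) \<Longrightarrow> (\<sigma> # \<Delta>) ! up_ren r k = (\<sigma> # \<Gamma>) ! k" for k
      using Lam.prems(2) by (cases k) auto
  qed
  then show ?case by simp
qed auto

lemma tyof_lift [simp]: "tyof (\<sigma> # \<Gamma>) (lift_tm t) = tyof \<Gamma> t"
  by (rule tyof_ren) auto

lemma tyof_sub:
  assumes "tyof \<Gamma> t = Some \<tau>" "\<And>k. k < length \<Gamma> \<Longrightarrow> tyof \<Delta> (s k) = Some (\<Gamma> ! k)"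
  shows "tyof \<Delta> (sub_tm s t) = Some \<tau>"
  using assms
proof (induction t arbitrary: \<Gamma> \<Delta> s \<tau>)
  case (App t u)
  then show ?case by (fastforce simp: app_ty_eq_Some_iff)
next
  case (Lam \<sigma> t)
  then obtain \<tau>' where \<tau>': "tyof (\<sigma> # \<Gamma>) t = Some \<tau>'" "\<tau> = \<sigma> \<rightarrow>\<^sub>t \<tau>'" by auto
  have "tyof (\<sigma> # \<Delta>) (sub_tm (up_sub s) t) = Some \<tau>'"
  proof (rule Lam.IH[OF \<tau>'(1)])
    show "k < length (\<sigma> # \<Gamma>) \<Longrightarrow> tyof (\<sigma> # \<Delta>) (up_sub s k) = Some ((\<sigma> # \<Gamma>) ! k)" for k
      using Lam.prems(2) by (cases k) (auto simp: up_sub_scons)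
  qed
  then show ?case by (simp add: \<tau>')
qed (auto split: if_splits)

lemma tyof_inst:
  assumes "tyof (\<sigma> # \<Gamma>) t = Some \<tau>" "tyof \<Gamma> u = Some \<sigma>"
  shows "tyof \<Gamma> (sub_tm (scons u Var) t) = Some \<tau>"
proof (rule tyof_sub[OF assms(1)])
  show "k < length (\<sigma> # \<Gamma>) \<Longrightarrow> tyof \<Gamma> (scons u Var k) = Some ((\<sigma> # \<Gamma>) ! k)" for k
    using assms(2) by (cases k) auto
qed

text \<open>A well-typed term mentions only indices of its context. The case that matters is the
  empty context: closed combinators are fixed by every substitution and every renaming.\<close>

lemma sub_tm_ident:
  assumes "tyof \<Gamma> t = Some \<tau>" "\<And>k. k < length \<Gamma> \<Longrightarrow> s k = Var k"
  shows "sub_tm s t = t"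
  using assms
proof (induction t arbitrary: \<Gamma> s \<tau>)
  case (App t u)
  then obtain \<sigma> where "tyof \<Gamma> t = Some (\<sigma> \<rightarrow>\<^sub>t \<tau>)" "tyof \<Gamma> u = Some \<sigma>"
    by (auto simp: app_ty_eq_Some_iff)
  with App.IH App.prems(2) show ?case by simp
next
  case (Lam \<sigma> t)
  then obtain \<tau>' where \<tau>': "tyof (\<sigma> # \<Gamma>) t = Some \<tau>'" by auto
  have "sub_tm (up_sub s) t = t"
  proof (rule Lam.IH[OF \<tau>'])
    show "k < length (\<sigma> # \<Gamma>) \<Longrightarrow> up_sub s k = Var k" for k
      using Lam.prems(2) by (cases k) (auto simp: up_sub_scons)
  qed
  then show ?case by simp
qed (auto split: if_splits)

lemma sub_closed: "tyof [] t = Some \<tau> \<Longrightarrow> sub_tm s t = t"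
  by (rule sub_tm_ident) auto

lemma ren_closed: "tyof [] t = Some \<tau> \<Longrightarrow> ren_tm r t = t"
  by (simp add: ren_tm_sub sub_closed)

lemma wf_ren:
  assumes "wf_fm \<Gamma> \<phi>" "\<And>k. r k < length \<Delta> \<longleftrightarrow> k < length \<Gamma>" "\<And>k. k < length \<Gamma> \<Longrightarrow> \<Delta> ! r k = \<Gamma> ! k"
  shows "wf_fm \<Delta> (ren_fm r \<phi>)"
  using assms
proof (induction \<phi> arbitrary: \<Gamma> \<Delta> r)
  case (All \<sigma> \<phi>)
  have "wf_fm (\<sigma> # \<Delta>) (ren_fm (up_ren r) \<phi>)"
  proof (rule All.IH)
    show "wf_fm (\<sigma> # \<Gamma>) \<phi>" using All.prems(1) by simp
    show "up_ren r k < length (\<sigma> # \<Delta>) \<longleftrightarrow> k < length (\<sigma> # \<Gamma>)" for k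
      using All.prems(2) by (cases k) auto
    show "k < length (\<sigma> # \<Gamma>) \<Longrightarrow> (\<sigma> # \<Delta>) ! up_ren r k = (\<sigma> # \<Gamma>) ! k" for k
      using All.prems(3) by (cases k) auto
  qed
  then show ?case by simp
next
  case (Ex \<sigma> \<phi>)
  have "wf_fm (\<sigma> # \<Delta>) (ren_fm (up_ren r) \<phi>)"
  proof (rule Ex.IH)
    show "wf_fm (\<sigma> # \<Gamma>) \<phi>" using Ex.prems(1) by simp
    show "up_ren r k < length (\<sigma> # \<Delta>) \<longleftrightarrow> k < length (\<sigma> # \<Gamma>)" for k
      using Ex.prems(2) by (cases k) auto
    show "k < length (\<sigma> # \<Gamma>) \<Longrightarrow> (\<sigma> # \<Delta>) ! up_ren r k = (\<sigma> # \<Gamma>) ! k" for k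
      using Ex.prems(3) by (cases k) auto
  qed
  then show ?case by simp
next
  case (Eq \<tau> t u)
  then show ?case using tyof_ren[of r \<Delta> \<Gamma>] by (simp add: has_type_iff)
qed auto

lemma wf_lift: "wf_fm \<Gamma> \<phi> \<Longrightarrow> wf_fm (\<sigma> # \<Gamma>) (lift_fm \<phi>)"
  by (rule wf_ren) auto

section \<open>Derived rules of the logic and of equality\<close>

lemma prv_mono: "T; \<Gamma>; H \<turnstile> \<phi> \<Longrightarrow> H \<subseteq> H' \<Longrightarrow> T; \<Gamma>; H' \<turnstile> \<phi>"
proof (induction arbitrary: H' rule: prv.induct)
  case (OrE \<Gamma> H \<phi> \<psi> \<chi>)
  then show ?case by (meson prv.OrE insert_mono)
next
  case (ImpI \<Gamma> \<phi> H \<psi>)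
  then show ?case by (meson prv.ImpI insert_mono)
next
  case (AllI \<tau> \<Gamma> H \<phi>)
  then show ?case by (meson prv.AllI image_mono)
next
  case (ExE \<Gamma> H \<tau> \<phi> \<psi>)
  then show ?case by (meson prv.ExE image_mono insert_mono)
next
  case (ImpE \<Gamma> H \<phi> \<psi>)
  then show ?case by (meson prv.ImpE)
next
  case (EqSubst \<Gamma> H \<tau> t u \<phi>)
  then show ?case by (meson prv.EqSubst)
qed (auto intro: prv.axiom prv.assm prv.BotE prv.AndI prv.OrI1 prv.OrI2 prv.AllE prv.ExI
    prv.EqRefl dest: prv.AndE1 prv.AndE2 subsetD)

lemma prv_cut:
  assumes "T; \<Gamma>; H \<turnstile> \<phi>" "T; \<Gamma>; insert \<phi> H \<turnstile> \<psi>" "wf_fm \<Gamma> \<phi>"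
  shows "T; \<Gamma>; H \<turnstile> \<psi>"
  using assms by (blast intro: prv.ImpE prv.ImpI)

lemma inst_fm_0: "inst_fm 0 t = sub_fm (scons t Var)"
  by (simp add: inst_fm_def inst_sub_scons fun_eq_iff)

lemma inst_tm_0: "inst_tm 0 t = sub_tm (scons t Var)"
  by (simp add: inst_tm_def inst_sub_scons fun_eq_iff)

text \<open>The shift is written as a composition with \<open>lift_tm\<close>, so that
  \<open>sub_ren_comp\<close> turns what remains after the instantiation into a plain lift.\<close>

lemma inst_fm_1: "inst_fm (Suc 0) t = sub_fm (scons t (lift_tm \<circ> Var))"
  by (simp add: inst_fm_def inst_sub_scons fun_eq_iff comp_def)

lemma inst_fm_2: "inst_fm 2 t = sub_fm (scons t (lift_tm \<circ> (lift_tm \<circ> Var)))"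
  by (simp add: inst_fm_def inst_sub_scons fun_eq_iff comp_def)

lemmas inst_simps = inst_fm_0 inst_tm_0 inst_fm_1 inst_fm_2 up_sub_scons has_type_iff

text \<open>Instantiating a quantifier under a substitution just extends the substitution. A block
  of nested quantifiers can thus be instantiated one by one, with the substitution carried out once
  at the end.\<close>

lemma AllE_sub:
  assumes "T; \<Gamma>; H \<turnstile> sub_fm s (All \<tau> \<phi>)" "\<Gamma> \<turnstile>\<^sub>t t : \<tau>"
  shows "T; \<Gamma>; H \<turnstile> sub_fm (scons t s) \<phi>"
  using prv.AllE[of T \<Gamma> H \<tau> _ t] assms by (fastforce simp: inst_fm_0 sub_scons_up_fm)

lemma AllE_assm:
  assumes "All \<tau> \<phi> \<in> H" "wf_fm \<Gamma> (All \<tau> \<phi>)" "\<Gamma> \<turnstile>\<^sub>t t : \<tau>"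
  shows "T; \<Gamma>; H \<turnstile> sub_fm (scons t Var) \<phi>"
  using prv.AllE[OF prv.assm[OF assms(1,2)] assms(3)] by (simp add: inst_fm_0)

lemma Eq_subst:
  assumes "T; \<Gamma>; H \<turnstile> Eq \<tau> t u" "T; \<Gamma>; H \<turnstile> sub_fm (scons t Var) \<phi>" "wf_fm (\<tau> # \<Gamma>) \<phi>"
  shows "T; \<Gamma>; H \<turnstile> sub_fm (scons u Var) \<phi>"
  using prv.EqSubst[of T \<Gamma> H \<tau> t u \<phi>] assms by (simp add: inst_fm_0)

lemma Eq_sym:
  assumes "T; \<Gamma>; H \<turnstile> Eq \<tau> t u" "tyof \<Gamma> t = Some \<tau>"
  shows "T; \<Gamma>; H \<turnstile> Eq \<tau> u t"
  using Eq_subst[OF assms(1), of "Eq \<tau> (Var 0) (lift_tm t)"] assms(2)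
  by (simp add: has_type_iff prv.EqRefl)

lemma Eq_trans:
  assumes "T; \<Gamma>; H \<turnstile> Eq \<tau> t u" "T; \<Gamma>; H \<turnstile> Eq \<tau> u v" "tyof \<Gamma> t = Some \<tau>"
  shows "T; \<Gamma>; H \<turnstile> Eq \<tau> t v"
  using Eq_subst[OF assms(2), of "Eq \<tau> (lift_tm t) (Var 0)"] assms(1,3)
  by (simp add: has_type_iff)

lemma Eq_App:
  assumes "T; \<Gamma>; H \<turnstile> Eq (\<sigma> \<rightarrow>\<^sub>t \<tau>) t t'" "T; \<Gamma>; H \<turnstile> Eq \<sigma> u u'"
    and "tyof \<Gamma> t = Some (\<sigma> \<rightarrow>\<^sub>t \<tau>)" "tyof \<Gamma> t' = Some (\<sigma> \<rightarrow>\<^sub>t \<tau>)" "tyof \<Gamma> u = Some \<sigma>"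
  shows "T; \<Gamma>; H \<turnstile> Eq \<tau> (t \<cdot> u) (t' \<cdot> u')"
proof -
  have refl: "T; \<Gamma>; H \<turnstile> Eq \<tau> (t \<cdot> u) (t \<cdot> u)"
    by (rule prv.EqRefl) (simp add: has_type_iff assms)
  have "T; \<Gamma>; H \<turnstile> Eq \<tau> (t \<cdot> u) (t' \<cdot> u)"
    using Eq_subst[OF assms(1), of "Eq \<tau> (lift_tm (t \<cdot> u)) (Var 0 \<cdot> lift_tm u)"] assms refl
    by (simp add: has_type_iff)
  then show ?thesis
    using Eq_subst[OF assms(2), of "Eq \<tau> (lift_tm (t \<cdot> u)) (lift_tm t' \<cdot> Var 0)"] assms
    by (simp add: has_type_iff)
qed

section \<open>The applicative structure of provably equal terms\<close>

locale HA_context =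
  fixes T :: thy and \<Gamma> :: ctx and H :: "fm set"
  assumes HA_subset: "HA_omega \<subseteq> T"
begin

lemma HA_axiom: "(\<Delta>, \<phi>) \<in> HA_omega \<Longrightarrow> T; \<Delta>; G \<turnstile> \<phi>"
  using HA_subset by (auto intro: prv.axiom)

lemma HA_context_T: "HA_context T"
  using HA_subset by unfold_locales

text \<open>The typing conditions give an ill-typed term the empty class. Equality of classes
  therefore always carries equality of types along with provable equality.\<close>

definition cls :: "tm \<Rightarrow> tm set" where
  "cls t = {u. \<exists>\<tau>. tyof \<Gamma> t = Some \<tau> \<and> tyof \<Gamma> u = Some \<tau> \<and> (T; \<Gamma>; H \<turnstile> Eq \<tau> t u)}"

text \<open>Type and application are defined on arbitrary sets, with a default value for those that are not
  classes, so that \<open>cls_App\<close>, \<open>tc_cls\<close> and \<open>tc_app\<close> hold without side conditions.\<close>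

definition tc :: "tm set \<Rightarrow> ty option" where
  "tc A = (if \<exists>a. A = cls a then tyof \<Gamma> (SOME a. A = cls a) else None)"

definition app :: "tm set \<Rightarrow> tm set \<Rightarrow> tm set"  (infixl "\<bullet>" 100) where
  "A \<bullet> B = (if (\<exists>a. A = cls a) \<and> (\<exists>b. B = cls b)
     then cls ((SOME a. A = cls a) \<cdot> (SOME b. B = cls b)) else {})"

lemma cls_self: "tyof \<Gamma> t = Some \<tau> \<Longrightarrow> t \<in> cls t"
  by (simp add: cls_def prv.EqRefl has_type_iff)

lemma cls_untyped: "tyof \<Gamma> t = None \<Longrightarrow> cls t = {}"
  by (simp add: cls_def)

lemma cls_eqI:
  assumes "T; \<Gamma>; H \<turnstile> Eq \<tau> t u" "tyof \<Gamma> t = Some \<tau>" "tyof \<Gamma> u = Some \<tau>"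
  shows "cls t = cls u"
  using assms(2,3) Eq_trans[OF assms(1) _ assms(2)] Eq_trans[OF Eq_sym[OF assms(1,2)] _ assms(3)]
  by (auto simp: cls_def)

text \<open>A typed term lies in its own class, so the class of \<open>u\<close> is nonempty; hence
  \<open>u\<close> is typed, lies in its own class, and so in that of \<open>t\<close>.\<close>

lemma cls_eqD:
  assumes "cls t = cls u" "tyof \<Gamma> t = Some \<tau>"
  shows "T; \<Gamma>; H \<turnstile> Eq \<tau> t u" "tyof \<Gamma> u = Some \<tau>"
proof -
  have "cls u \<noteq> {}" using cls_self[OF assms(2)] assms(1) by auto
  then have "tyof \<Gamma> u \<noteq> None" using cls_untyped by blast
  then have "u \<in> cls t" using cls_self assms(1) by auto
  then show "T; \<Gamma>; H \<turnstile> Eq \<tau> t u" "tyof \<Gamma> u = Some \<tau>"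
    using assms(2) by (auto simp: cls_def)
qed

lemma cls_eq_tyof: "cls t = cls u \<Longrightarrow> tyof \<Gamma> t = tyof \<Gamma> u"
  using cls_eqD(2)[of t u] cls_eqD(2)[of u t] by (cases "tyof \<Gamma> t"; cases "tyof \<Gamma> u") auto

lemma tc_cls [simp]: "tc (cls t) = tyof \<Gamma> t"
proof -
  have "cls t = cls (SOME a. cls t = cls a)" by (rule someI[of _ t]) (rule refl)
  then have "tyof \<Gamma> (SOME a. cls t = cls a) = tyof \<Gamma> t" by (rule cls_eq_tyof[symmetric])
  moreover have "\<exists>a. cls t = cls a" by blast
  ultimately show ?thesis by (simp only: tc_def if_True)
qed

text \<open>This makes application of classes independent of the chosen representatives. If the
  application is ill-typed, both sides are empty.\<close>

lemma cls_App_cong: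
  assumes "cls t = cls t'" "cls u = cls u'"
  shows "cls (t \<cdot> u) = cls (t' \<cdot> u')"
proof (cases "tyof \<Gamma> (t \<cdot> u)")
  case None
  then have "tyof \<Gamma> (t' \<cdot> u') = None" 
    using cls_eq_tyof[OF assms(1)] cls_eq_tyof[OF assms(2)] by simp
  with None show ?thesis by (simp add: cls_untyped)
next
  case (Some \<tau>)
  then obtain \<sigma> where \<sigma>: "tyof \<Gamma> t = Some (\<sigma> \<rightarrow>\<^sub>t \<tau>)" "tyof \<Gamma> u = Some \<sigma>"
    by (auto simp: app_ty_eq_Some_iff)
  note t = cls_eqD[OF assms(1) \<sigma>(1)] and u = cls_eqD[OF assms(2) \<sigma>(2)]
  show ?thesis
    by (rule cls_eqI[OF Eq_App[OF t(1) u(1) \<sigma>(1) t(2) \<sigma>(2)]]) (simp_all add: \<sigma> t u)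
qed

lemma cls_App [simp]: "cls (t \<cdot> u) = cls t \<bullet> cls u"
proof -
  have "cls t = cls (SOME a. cls t = cls a)" "cls u = cls (SOME a. cls u = cls a)"
    by (rule someI[of _ t], rule refl) (rule someI[of _ u], rule refl)
  from cls_App_cong[OF this] have "cls (t \<cdot> u)
      = cls ((SOME a. cls t = cls a) \<cdot> (SOME b. cls u = cls b))" .
  moreover have "(\<exists>a. cls t = cls a) \<and> (\<exists>b. cls u = cls b)" by blast
  ultimately show ?thesis by (simp only: app_def if_True simp_thms)
qed

lemma tcE:
  assumes "tc A = Some \<sigma>"
  obtains a where "A = cls a" "tyof \<Gamma> a = Some \<sigma>"
  using assms by (metis tc_cls tc_def option.distinct(1))

lemma tc_app [simp]: "tc (A \<bullet> B) = app_ty (tc A) (tc B)"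
proof (cases "(\<exists>a. A = cls a) \<and> (\<exists>b. B = cls b)")
  case True
  then obtain a b where "A = cls a" "B = cls b" by blast
  then show ?thesis by (simp flip: cls_App)
next
  case False
  have "tc {} = None"
  proof (cases "tc {}")
    case (Some \<tau>)
    then obtain a where "{} = cls a" "tyof \<Gamma> a = Some \<tau>" by (rule tcE)
    then show ?thesis using cls_self by blast
  qed
  moreover have "A \<bullet> B = {}" unfolding app_def using False by (rule if_not_P)
  moreover have "tc A = None \<or> tc B = None"
    using False unfolding tc_def by presburger
  ultimately show ?thesis by auto
qed

text \<open>The body is only required to have some type. This leaves no type to be guessed, so the
  condition is checked by evaluating \<open>tyof\<close> during rewriting.\<close>

lemma cls_beta [simp]:
  assumes "tyof (\<sigma> # \<Gamma>) t \<noteq> None" "tyof \<Gamma> u = Some \<sigma>"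
  shows "cls (Lam \<sigma> t) \<bullet> cls u = cls (sub_tm (scons u Var) t)"
proof -
  obtain \<tau> where \<tau>: "tyof (\<sigma> # \<Gamma>) t = Some \<tau>" using assms(1) by blast
  have "(\<Gamma>, Eq \<tau> (Lam \<sigma> t \<cdot> u) (sub_tm (scons u Var) t)) \<in> HA_omega"
    using HA_omega.beta[of \<sigma> \<Gamma> t \<tau> u] \<tau> assms(2) by (simp add: has_type_iff inst_tm_0)
  from cls_eqI[OF HA_axiom[OF this]] show ?thesis
    using \<tau> assms(2) by (simp add: tyof_inst)
qed

lemma cls_HA_eqI:
  assumes "(\<Gamma>, Eq \<tau> t u) \<in> HA_omega" "tyof \<Gamma> t = Some \<tau>" "tyof \<Gamma> u = Some \<tau>"
  shows "cls t = cls u"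
  by (rule cls_eqI[OF HA_axiom[OF assms(1)]]) fact+

text \<open>This and the following rules speak of sets with a known \<open>tc\<close> instead of
  terms, since \<open>cls_App\<close> has by then broken terms into applications of classes.
  Representatives are recovered by \<open>tcE\<close>.\<close>

lemma cond_True [simp]:
  assumes "tc A = Some \<tau>" "tc B = Some \<tau>"
  shows "cls (Const (CondC \<tau>)) \<bullet> cls (Const TrueC) \<bullet> A \<bullet> B = A"
  using assms
  by (elim tcE) (simp add: has_type_iff cls_HA_eqI[OF HA_omega.cond_true] flip: cls_App)

lemma cond_False [simp]:
  assumes "tc A = Some \<tau>" "tc B = Some \<tau>"
  shows "cls (Const (CondC \<tau>)) \<bullet> cls (Const FalseC) \<bullet> A \<bullet> B = B"
  using assms
  by (elim tcE) (simp add: has_type_iff cls_HA_eqI[OF HA_omega.cond_false] flip: cls_App)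

lemma fst_pair [simp]:
  assumes "tc A = Some \<sigma>" "tc B = Some \<tau>"
  shows "cls (Const (FstC \<sigma> \<tau>)) \<bullet> (cls (Const (PairC \<sigma> \<tau>)) \<bullet> A \<bullet> B) = A"
  using assms
  by (elim tcE) (simp add: has_type_iff cls_HA_eqI[OF HA_omega.fst_pair] flip: cls_App)

lemma snd_pair [simp]:
  assumes "tc A = Some \<sigma>" "tc B = Some \<tau>"
  shows "cls (Const (SndC \<sigma> \<tau>)) \<bullet> (cls (Const (PairC \<sigma> \<tau>)) \<bullet> A \<bullet> B) = B"
  using assms
  by (elim tcE) (simp add: has_type_iff cls_HA_eqI[OF HA_omega.snd_pair] flip: cls_App)

lemma rec_succ [simp]:
  assumes "tc A = Some \<tau>" "tc F = Some (NatT \<rightarrow>\<^sub>t \<tau> \<rightarrow>\<^sub>t \<tau>)" "tc N = Some NatT"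
  shows "cls (Const (RecC \<tau>)) \<bullet> A \<bullet> F \<bullet> (cls (Const SuccC) \<bullet> N)
    = F \<bullet> N \<bullet> (cls (Const (RecC \<tau>)) \<bullet> A \<bullet> F \<bullet> N)"
  using assms
  by (elim tcE) (simp add: has_type_iff cls_HA_eqI[OF HA_omega.rec_succ] flip: cls_App)

lemma seqrec_empty [simp]:
  assumes "tc A = Some \<tau>" "tc F = Some (SeqT \<sigma> \<rightarrow>\<^sub>t \<sigma> \<rightarrow>\<^sub>t \<tau> \<rightarrow>\<^sub>t \<tau>)"
  shows "cls (Const (SeqRecC \<sigma> \<tau>)) \<bullet> A \<bullet> F \<bullet> cls (Empty \<sigma>) = A"
  using assms
  by (elim tcE) (simp add: has_type_iff cls_HA_eqI[OF HA_omega.seqrec_empty] flip: cls_App)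

lemma seqrec_snoc [simp]:
  assumes "tc A = Some \<tau>" "tc F = Some (SeqT \<sigma> \<rightarrow>\<^sub>t \<sigma> \<rightarrow>\<^sub>t \<tau> \<rightarrow>\<^sub>t \<tau>)"
    "tc S = Some (SeqT \<sigma>)" "tc Y = Some \<sigma>"
  shows "cls (Const (SeqRecC \<sigma> \<tau>)) \<bullet> A \<bullet> F \<bullet> (cls (Const (SnocC \<sigma>)) \<bullet> S \<bullet> Y)
    = F \<bullet> S \<bullet> Y \<bullet> (cls (Const (SeqRecC \<sigma> \<tau>)) \<bullet> A \<bullet> F \<bullet> S)"
  using assms
  by (elim tcE) (simp add: has_type_iff cls_HA_eqI[OF HA_omega.seqrec_snoc] flip: cls_App)

text \<open>This replaces congruence under a binder: two functions are compared at a fresh variable,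
  in the extended context and under the lifted assumptions.\<close>

lemma cls_ext:
  assumes "HA_context.cls T (\<sigma> # \<Gamma>) (lift_fm ` H) (lift_tm f \<cdot> Var 0)
      = HA_context.cls T (\<sigma> # \<Gamma>) (lift_fm ` H) (lift_tm g \<cdot> Var 0)"
    and "tyof \<Gamma> f = Some (\<sigma> \<rightarrow>\<^sub>t \<tau>)" "tyof \<Gamma> g = Some (\<sigma> \<rightarrow>\<^sub>t \<tau>)"
  shows "cls f = cls g"
proof -
  interpret U: HA_context T "\<sigma> # \<Gamma>" "lift_fm ` H" by (rule HA_context_T)
  have "T; \<sigma> # \<Gamma>; lift_fm ` H \<turnstile> Eq \<tau> (lift_tm f \<cdot> Var 0) (lift_tm g \<cdot> Var 0)"
    by (rule U.cls_eqD(1)[OF assms(1)]) (simp add: assms(2))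
  then have "T; \<Gamma>; H \<turnstile> All \<sigma> (Eq \<tau> (lift_tm f \<cdot> Var 0) (lift_tm g \<cdot> Var 0))"
    by (rule prv.AllI)
  from prv.ImpE[OF HA_axiom[OF HA_omega.ext] this] assms(2,3)
  have "T; \<Gamma>; H \<turnstile> Eq (\<sigma> \<rightarrow>\<^sub>t \<tau>) f g" by (simp add: has_type_iff)
  with assms(2,3) show ?thesis by (intro cls_eqI)
qed

lemma bool_cases:
  assumes "tyof \<Gamma> b = Some BoolT"
  shows "T; \<Gamma>; H \<turnstile> Or (Eq BoolT b (Const TrueC)) (Eq BoolT b (Const FalseC))"
proof -
  let ?\<phi> = "Or (Eq BoolT (Var 0) (Const TrueC)) (Eq BoolT (Var 0) (Const FalseC))"
  have ax: "T; \<Gamma>; H \<turnstile> inst_fm 0 (Const TrueC) ?\<phi> \<supset> inst_fm 0 (Const FalseC) ?\<phi> \<supset> All BoolT ?\<phi>"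
    by (intro HA_axiom HA_omega.bool_ind) (simp add: has_type_iff)
  have "T; \<Gamma>; H \<turnstile> inst_fm 0 (Const TrueC) ?\<phi>"
    by (simp add: inst_fm_0) (intro prv.OrI1 prv.EqRefl, simp_all add: has_type_iff)
  moreover have "T; \<Gamma>; H \<turnstile> inst_fm 0 (Const FalseC) ?\<phi>"
    by (simp add: inst_fm_0) (intro prv.OrI2 prv.EqRefl, simp_all add: has_type_iff)
  ultimately have "T; \<Gamma>; H \<turnstile> All BoolT ?\<phi>" using ax prv.ImpE by blast
  from prv.AllE[OF this, of b] assms show ?thesis by (simp add: has_type_iff inst_fm_0)
qed

text \<open>Boolean induction decides the value of \<open>b\<close>, so this case distinction is
  intuitionistically valid. Each case is an equation of classes over a larger set of
  assumptions.\<close>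

lemma cls_bool_cases:
  assumes "tyof \<Gamma> b = Some BoolT" "tyof \<Gamma> t = Some \<tau>"
    and "HA_context.cls T \<Gamma> (insert (Eq BoolT b (Const TrueC)) H) t
      = HA_context.cls T \<Gamma> (insert (Eq BoolT b (Const TrueC)) H) u"
    and "HA_context.cls T \<Gamma> (insert (Eq BoolT b (Const FalseC)) H) t
      = HA_context.cls T \<Gamma> (insert (Eq BoolT b (Const FalseC)) H) u"
  shows "cls t = cls u"
proof -
  interpret U: HA_context T \<Gamma> "insert (Eq BoolT b (Const TrueC)) H" by (rule HA_context_T)
  interpret V: HA_context T \<Gamma> "insert (Eq BoolT b (Const FalseC)) H" by (rule HA_context_T)
  from prv.OrE[OF bool_cases U.cls_eqD(1) V.cls_eqD(1), OF assms(1,3,2,4,2)]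
  show ?thesis by (rule cls_eqI[OF _ assms(2) U.cls_eqD(2)[OF assms(3,2)]])
qed

lemma cls_assm:
  assumes "Eq \<tau> t u \<in> H" "tyof \<Gamma> t = Some \<tau>" "tyof \<Gamma> u = Some \<tau>"
  shows "cls t = cls u"
  by (rule cls_eqI[OF prv.assm]) (use assms in \<open>simp_all add: has_type_iff\<close>)

end

section \<open>Decreasing functions on the natural numbers, and bar induction for equations\<close>

lemma tyof_segment [simp]: "tyof \<Gamma> (segment X) = Some ((NatT \<rightarrow>\<^sub>t X) \<rightarrow>\<^sub>t NatT \<rightarrow>\<^sub>t SeqT X)"
  by (simp add: segment_def)

lemma ren_segment [simp]: "ren_tm r (segment X) = segment X"
  by (rule ren_closed) (rule tyof_segment)

lemma sub_segment [simp]: "sub_tm s (segment X) = segment X"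
  by (rule sub_closed) (rule tyof_segment)

context HA_context
begin

lemma Succ_not_Zero:
  assumes "T; \<Gamma>; H \<turnstile> Eq NatT (Succ t) Zero" "tyof \<Gamma> t = Some NatT"
  shows "T; \<Gamma>; H \<turnstile> Bot"
  by (rule prv.ImpE[OF HA_axiom[OF HA_omega.succ_not_zero] assms(1)])
    (simp add: has_type_iff assms(2))

lemma Succ_inject:
  assumes "T; \<Gamma>; H \<turnstile> Eq NatT (Succ t) (Succ u)" "tyof \<Gamma> t = Some NatT" "tyof \<Gamma> u = Some NatT"
  shows "T; \<Gamma>; H \<turnstile> Eq NatT t u"
  by (rule prv.ImpE[OF HA_axiom[OF HA_omega.succ_inj] assms(1)])
    (simp_all add: has_type_iff assms(2,3))

text \<open>The assumption in \<open>H\<close> says that at each argument either the goal holds or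
  \<open>g\<close> drops by one. Having the goal itself as the alternative avoids an argument by
  contradiction, so in proving it the drop at \<open>t\<close> may be assumed.\<close>

lemma decreasing_cases:
  assumes "All NatT (Or (lift_fm \<chi>) (Eq NatT (lift_tm g \<cdot> Var 0) (Succ (lift_tm g \<cdot> Succ (Var 0))))) \<in> H"
    and "tyof \<Gamma> g = Some (NatT \<rightarrow>\<^sub>t NatT)" "wf_fm \<Gamma> \<chi>" "tyof \<Gamma> t = Some NatT"
    and "T; \<Gamma>; insert (Eq NatT (g \<cdot> t) (Succ (g \<cdot> Succ t))) H \<turnstile> \<chi>"
  shows "T; \<Gamma>; H \<turnstile> \<chi>"
proof -
  note [simp] = inst_simps wf_lift assms(2-4)
  have "T; \<Gamma>; H \<turnstile> Or \<chi> (Eq NatT (g \<cdot> t) (Succ (g \<cdot> Succ t)))"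
    using AllE_assm[OF assms(1), of \<Gamma> t T] by simp
  then show ?thesis by (rule prv.OrE[OF _ prv.assm assms(5)]) simp_all
qed

text \<open>Derivations are not weakened in their contexts; instead a fact needed under further quantifiers
  is cut into H, where the rules lift it.\<close>

lemma decreasing_nat:
  assumes g: "tyof \<Gamma> g = Some (NatT \<rightarrow>\<^sub>t NatT)" and \<chi>: "wf_fm \<Gamma> \<chi>"
    and D: "T; \<Gamma>; H \<turnstile> All NatT (Or (lift_fm \<chi>)
      (Eq NatT (lift_tm g \<cdot> Var 0) (Succ (lift_tm g \<cdot> Succ (Var 0)))))" (is "T; \<Gamma>; H \<turnstile> ?D")
  shows "T; \<Gamma>; H \<turnstile> \<chi>"
proof (rule prv_cut[OF D])
  note [simp] = inst_simps wf_lift g \<chi>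
  show "wf_fm \<Gamma> ?D" by simp
  \<comment> \<open>As a property of m (variable 1 under the quantifier): if \<open>g\<close> takes
    the value m at some argument j, the goal follows. The induction is on this value, with j left
    general.\<close>
  define \<psi> where "\<psi> = All NatT
    (Eq NatT (lift_tm (lift_tm g) \<cdot> Var 0) (Var 1) \<supset> lift_fm (lift_fm \<chi>))"
  have \<psi>_wf: "wf_fm (NatT # \<Gamma>) \<psi>" by (simp add: \<psi>_def)
  let ?H = "insert ?D H"
  have "T; \<Gamma>; ?H \<turnstile> inst_fm 0 Zero \<psi>"
  proof -
    let ?u = "lift_tm g \<cdot> Var 0" and ?v = "lift_tm g \<cdot> Succ (Var 0)"
    let ?H1 = "insert (Eq NatT ?u Zero) (lift_fm ` ?H)"
    interpret U: HA_context T "NatT # \<Gamma>" ?H1 by (rule HA_context_T)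
    \<comment> \<open>From the value 0 no further drop is possible: it would make a successor equal
      to zero.\<close>
    have "T; NatT # \<Gamma>; ?H1 \<turnstile> lift_fm \<chi>"
    proof (rule U.decreasing_cases)
      let ?H2 = "insert (Eq NatT ?u (Succ ?v)) ?H1"
      interpret V: HA_context T "NatT # \<Gamma>" ?H2 by (rule HA_context_T)
      have "V.cls ?u = V.cls Zero" "V.cls ?u = V.cls (Succ ?v)"
        by (rule V.cls_assm[where \<tau> = NatT]; simp)+
      then have "V.cls (Succ ?v) = V.cls Zero" by simp
      then have "T; NatT # \<Gamma>; ?H2 \<turnstile> Eq NatT (Succ ?v) Zero"
        by (rule V.cls_eqD(1)) simp
      then have "T; NatT # \<Gamma>; ?H2 \<turnstile> Bot" by (rule V.Succ_not_Zero) simp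
      then show "T; NatT # \<Gamma>; ?H2 \<turnstile> lift_fm \<chi>" by (rule prv.BotE) simp
    qed simp_all
    then show ?thesis by (auto simp: \<psi>_def intro!: prv.AllI prv.ImpI)
  qed
  moreover have "T; \<Gamma>; ?H \<turnstile> All NatT (\<psi> \<supset> inst_fm 1 (Succ (Var 0)) \<psi>)"
  proof -
    let ?\<Delta> = "NatT # NatT # \<Gamma>" and ?g = "lift_tm (lift_tm g)" and ?\<chi> = "lift_fm (lift_fm \<chi>)"
    let ?u = "?g \<cdot> Var 0" and ?v = "?g \<cdot> Succ (Var 0)"
    let ?H1 = "insert (Eq NatT ?u (Succ (Var 1))) (lift_fm ` insert \<psi> (lift_fm ` ?H))"
    interpret U: HA_context T ?\<Delta> ?H1 by (rule HA_context_T)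
    have "T; ?\<Delta>; ?H1 \<turnstile> ?\<chi>"
    proof (rule U.decreasing_cases)
      let ?H2 = "insert (Eq NatT ?u (Succ ?v)) ?H1"
      interpret V: HA_context T ?\<Delta> ?H2 by (rule HA_context_T)
      have "V.cls ?u = V.cls (Succ (Var 1))" "V.cls ?u = V.cls (Succ ?v)"
        by (rule V.cls_assm[where \<tau> = NatT]; simp)+
      then have "V.cls (Succ ?v) = V.cls (Succ (Var 1))" by simp
      then have "T; ?\<Delta>; ?H2 \<turnstile> Eq NatT (Succ ?v) (Succ (Var 1))"
        by (rule V.cls_eqD(1)) simp
      then have *: "T; ?\<Delta>; ?H2 \<turnstile> Eq NatT ?v (Var 1)"
        by (rule V.Succ_inject) simp_all
      \<comment> \<open>From g(j) = m + 1 and g(j) = g(j+1) + 1 comes g(j+1) = m, so the induction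
        hypothesis is used at j + 1.\<close>
      have "lift_fm \<psi> \<in> ?H2" by simp
      from AllE_assm[OF this[unfolded \<psi>_def ren_fm.simps], of ?\<Delta> "Succ (Var 0)" T]
      have "T; ?\<Delta>; ?H2 \<turnstile> Eq NatT ?v (Var 1) \<supset> ?\<chi>"
        by (simp add: \<psi>_def)
      then show "T; ?\<Delta>; ?H2 \<turnstile> ?\<chi>" using * by (rule prv.ImpE)
    qed simp_all
    then have "T; NatT # \<Gamma>; insert \<psi> (lift_fm ` ?H) \<turnstile> inst_fm 1 (Succ (Var 0)) \<psi>"
      by (auto simp: \<psi>_def intro!: prv.AllI prv.ImpI)
    then show ?thesis using \<psi>_wf by (intro prv.AllI prv.ImpI)
  qed
  ultimately have "T; \<Gamma>; ?H \<turnstile> All NatT \<psi>"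
    by (rule prv.ImpE[OF prv.ImpE[OF HA_axiom[OF HA_omega.nat_ind[OF \<psi>_wf]]]])
  \<comment> \<open>The induction is started with m = g(0) and j = 0.\<close>
  from prv.AllE[OF this, of "g \<cdot> Zero"]
  have "T; \<Gamma>; ?H \<turnstile> All NatT (Eq NatT (lift_tm g \<cdot> Var 0) (lift_tm g \<cdot> Zero) \<supset> lift_fm \<chi>)"
    by (simp add: \<psi>_def)
  from prv.AllE[OF this, of Zero] have "T; \<Gamma>; ?H \<turnstile> Eq NatT (g \<cdot> Zero) (g \<cdot> Zero) \<supset> \<chi>"
    by simp
  then show "T; \<Gamma>; ?H \<turnstile> \<chi>" by (rule prv.ImpE) (simp add: prv.EqRefl)
qed

text \<open>Bar induction for the predicate f(s) = g(s), with the bar given by the boolean function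
  \<open>b\<close>. As \<open>b\<close> is decidable, the inductive step may assume that
  \<open>s\<close> is not yet on the bar.\<close>

lemma bar_induction_eq:
  assumes BI: "BI \<subseteq> T"
    and [simp]: "tyof \<Gamma> f = Some (SeqT X \<rightarrow>\<^sub>t \<tau>)" "tyof \<Gamma> g = Some (SeqT X \<rightarrow>\<^sub>t \<tau>)"
      "tyof \<Gamma> b = Some (SeqT X \<rightarrow>\<^sub>t BoolT)"
    and bar: "T; (NatT \<rightarrow>\<^sub>t X) # \<Gamma>; lift_fm ` H \<turnstile> Ex NatT
      (Eq BoolT (lift_tm (lift_tm b) \<cdot> (segment X \<cdot> Var 1 \<cdot> Var 0)) (Const TrueC))"
    and base: "HA_context.cls T (SeqT X # \<Gamma>)
        (insert (Eq BoolT (lift_tm b \<cdot> Var 0) (Const TrueC)) (lift_fm ` H)) (lift_tm f \<cdot> Var 0)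
      = HA_context.cls T (SeqT X # \<Gamma>)
        (insert (Eq BoolT (lift_tm b \<cdot> Var 0) (Const TrueC)) (lift_fm ` H)) (lift_tm g \<cdot> Var 0)"
    and step: "HA_context.cls T (SeqT X # \<Gamma>)
        (insert (Eq BoolT (lift_tm b \<cdot> Var 0) (Const FalseC)) (insert
          (All X (Eq \<tau> (lift_tm (lift_tm f) \<cdot> Snoc X (Var 1) (Var 0))
            (lift_tm (lift_tm g) \<cdot> Snoc X (Var 1) (Var 0)))) (lift_fm ` H))) (lift_tm f \<cdot> Var 0)
      = HA_context.cls T (SeqT X # \<Gamma>)
        (insert (Eq BoolT (lift_tm b \<cdot> Var 0) (Const FalseC)) (insert
          (All X (Eq \<tau> (lift_tm (lift_tm f) \<cdot> Snoc X (Var 1) (Var 0))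
            (lift_tm (lift_tm g) \<cdot> Snoc X (Var 1) (Var 0)))) (lift_fm ` H))) (lift_tm g \<cdot> Var 0)"
  shows "cls (f \<cdot> Empty X) = cls (g \<cdot> Empty X)"
proof -
  note [simp] = inst_simps
  let ?b = "Eq BoolT (lift_tm b \<cdot> Var 0)"
  \<comment> \<open>A true equation as the relativising predicate: the induction ranges over all
    finite sequences.\<close>
  let ?S = "Eq BoolT (Const TrueC) (Const TrueC)"
  define P where "P = Eq \<tau> (lift_tm f \<cdot> Var 0) (lift_tm g \<cdot> Var 0)"
  \<comment> \<open>The base case as one formula. Cut into the assumptions, it is lifted by the
    quantifier rules and can be instantiated at an initial segment.\<close>
  let ?D = "All (SeqT X) (?b (Const TrueC) \<supset> P)"
  let ?\<Delta> = "SeqT X # \<Gamma>"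
  let ?H = "insert ?D H"
  have [simp]: "wf_fm ?\<Delta> P" by (simp add: P_def)
  have P_Snoc: "inst_fm 2 (Snoc X (Var 1) (Var 0)) P
      = Eq \<tau> (lift_tm (lift_tm f) \<cdot> Snoc X (Var 1) (Var 0))
          (lift_tm (lift_tm g) \<cdot> Snoc X (Var 1) (Var 0))"
    by (simp add: P_def)
  let ?P' = "inst_fm 2 (segment X \<cdot> Var 1 \<cdot> Var 0) P"
  have P_seg: "?P' = Eq \<tau> (lift_tm (lift_tm f) \<cdot> (segment X \<cdot> Var 1 \<cdot> Var 0))
          (lift_tm (lift_tm g) \<cdot> (segment X \<cdot> Var 1 \<cdot> Var 0))"
    by (simp add: P_def)
  interpret B: HA_context T ?\<Delta> "insert (?b (Const TrueC)) (lift_fm ` H)" by (rule HA_context_T)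
  have D1: "T; ?\<Delta>; insert (?b (Const TrueC)) (lift_fm ` H) \<turnstile> P"
    unfolding P_def by (rule B.cls_eqD(1)[OF base]) simp
  have D: "T; \<Gamma>; H \<turnstile> ?D"
    by (intro prv.AllI prv.ImpI D1) simp
  have "T; \<Gamma>; ?H \<turnstile> inst_fm 0 (Empty X) P"
  proof -
    have 1: "T; \<Gamma>; ?H \<turnstile> inst_fm 0 (Empty X) ?S" by (simp add: prv.EqRefl)
    have 2: "T; \<Gamma>; ?H \<turnstile> All (NatT \<rightarrow>\<^sub>t X)
            (All NatT (inst_fm 2 (segment X \<cdot> Var 1 \<cdot> Var 0) ?S)
              \<supset> Ex NatT (inst_fm 2 (segment X \<cdot> Var 1 \<cdot> Var 0) P))" (is "_; _; _ \<turnstile> All _ (?A \<supset> ?E)")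
    proof (intro prv.AllI prv.ImpI)
      let ?H1 = "insert ?A (lift_fm ` ?H)"
      let ?b' = "Eq BoolT (lift_tm (lift_tm b) \<cdot> (segment X \<cdot> Var 1 \<cdot> Var 0)) (Const TrueC)"
      let ?H2 = "insert ?b' (lift_fm ` ?H1)"
      let ?\<Delta>' = "NatT # (NatT \<rightarrow>\<^sub>t X) # \<Gamma>"
      have "lift_fm (lift_fm ?D) \<in> ?H2" by simp
      from AllE_assm[OF this[unfolded ren_fm.simps], of ?\<Delta>' "segment X \<cdot> Var 1 \<cdot> Var 0" T]
      have "T; ?\<Delta>'; ?H2 \<turnstile> ?b' \<supset> ?P'" by (simp add: P_def)
      then have *: "T; ?\<Delta>'; ?H2 \<turnstile> ?P'"
        by (rule prv.ImpE[OF _ prv.assm]) simp_all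
      \<comment> \<open>The length at which \<open>b\<close> becomes true also witnesses the
        existential statement for \<open>P\<close>.\<close>
      have E: "T; ?\<Delta>'; ?H2 \<turnstile> lift_fm ?E"
        using prv.ExI[of T ?\<Delta>' ?H2 "Var 0" "ren_fm (up_ren Suc) ?P'" NatT] *
        unfolding P_seg by simp
      have "T; (NatT \<rightarrow>\<^sub>t X) # \<Gamma>; ?H1 \<turnstile> Ex NatT ?b'"
        by (rule prv_mono[OF bar]) auto
      from prv.ExE[OF this E] show "T; (NatT \<rightarrow>\<^sub>t X) # \<Gamma>; ?H1 \<turnstile> ?E"
        by (simp add: P_def)
    qed simp
    have 3: "T; \<Gamma>; ?H \<turnstile> All (SeqT X)
            (?S \<supset> All X (inst_fm 2 (Snoc X (Var 1) (Var 0)) ?S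
                      \<supset> inst_fm 2 (Snoc X (Var 1) (Var 0)) P)
               \<supset> P)" (is "_; _; _ \<turnstile> All _ (_ \<supset> ?I \<supset> _)")
    proof (intro prv.AllI prv.ImpI)
      let ?H1 = "insert ?I (insert ?S (lift_fm ` ?H))"
      \<comment> \<open>The hypothesis supplied by bar induction, freed from its trivially true
        premise.\<close>
      let ?IH = "All X (inst_fm 2 (Snoc X (Var 1) (Var 0)) P)"
      show "T; ?\<Delta>; ?H1 \<turnstile> P"
      proof (rule prv_cut)
        show IH_wf: "wf_fm ?\<Delta> ?IH" by (simp add: P_def)
        show "T; ?\<Delta>; ?H1 \<turnstile> ?IH"
        proof (rule prv.AllI)
          let ?J = "inst_fm 2 (Snoc X (Var 1) (Var 0))"
          have "lift_fm ?I \<in> lift_fm ` ?H1" by simp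
          from AllE_assm[OF this[unfolded ren_fm.simps], of "X # ?\<Delta>" "Var 0" T]
          have "T; X # ?\<Delta>; lift_fm ` ?H1 \<turnstile> ?J ?S \<supset> ?J P" by (simp add: P_def)
          then show "T; X # ?\<Delta>; lift_fm ` ?H1 \<turnstile> ?J P"
            by (rule prv.ImpE) (simp add: prv.EqRefl)
        qed
        let ?H2 = "insert (?b (Const FalseC)) (insert ?IH (lift_fm ` H))"
        interpret C: HA_context T ?\<Delta> ?H2 by (rule HA_context_T)
        interpret C1: HA_context T ?\<Delta> "insert ?IH ?H1" by (rule HA_context_T)
        have s: "T; ?\<Delta>; ?H2 \<turnstile> Eq \<tau> (lift_tm f \<cdot> Var 0) (lift_tm g \<cdot> Var 0)"
          by (rule C.cls_eqD(1)[OF step[folded P_Snoc]]) simp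
        \<comment> \<open>If \<open>b\<close> holds at the current sequence this is the base case,
          otherwise the step.\<close>
        show "T; ?\<Delta>; insert ?IH ?H1 \<turnstile> P"
          by (rule prv.OrE[OF C1.bool_cases[of "lift_tm b \<cdot> Var 0"] prv_mono[OF D1] prv_mono[OF s[folded P_def]]]) auto
      qed
    qed (simp_all add: P_def)
    have "(\<Gamma>, inst_fm 0 (Empty X) ?S
        \<supset> All (NatT \<rightarrow>\<^sub>t X)
            (All NatT (inst_fm 2 (segment X \<cdot> Var 1 \<cdot> Var 0) ?S)
              \<supset> Ex NatT (inst_fm 2 (segment X \<cdot> Var 1 \<cdot> Var 0) P))
        \<supset> All (SeqT X)
            (?S \<supset> All X (inst_fm 2 (Snoc X (Var 1) (Var 0)) ?S
                      \<supset> inst_fm 2 (Snoc X (Var 1) (Var 0)) P)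
               \<supset> P)
        \<supset> inst_fm 0 (Empty X) P) \<in> T"
      using BI BI.BI[of X \<Gamma> ?S P] by auto
    from prv.ImpE[OF prv.ImpE[OF prv.ImpE[OF prv.axiom[OF this] 1] 2] 3] show ?thesis .
  qed
  then have "T; \<Gamma>; H \<turnstile> inst_fm 0 (Empty X) P" by (rule prv_cut[OF D]) simp
  then have "T; \<Gamma>; H \<turnstile> Eq \<tau> (f \<cdot> Empty X) (g \<cdot> Empty X)" by (simp add: P_def)
  then show ?thesis by (rule cls_eqI) simp_all
qed

end

declare J_def [simp] K_def [simp] epq_type_def [simp] eps_type_def [simp]

lemma up_ren_numeral [simp]: "up_ren r (numeral k) = Suc (r (pred_numeral k))"
  by (simp add: numeral_eq_Suc)

lemma zero_closed [simp]:
  "tyof \<Gamma> (zero \<tau>) = Some \<tau>" "ren_tm r (zero \<tau>) = zero \<tau>" "sub_tm s (zero \<tau>) = zero \<tau>"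
proof -
  have *: "tyof \<Gamma> (zero \<tau>) = Some \<tau>" for \<Gamma>
    by (induction \<tau> arbitrary: \<Gamma>) simp_all
  show "tyof \<Gamma> (zero \<tau>) = Some \<tau>" by (rule *)
  show "ren_tm r (zero \<tau>) = zero \<tau>" by (rule ren_closed) (rule *)
  show "sub_tm s (zero \<tau>) = zero \<tau>" by (rule sub_closed) (rule *)
qed

lemma less_closed [simp]:
  "tyof \<Gamma> less_tm = Some (NatT \<rightarrow>\<^sub>t NatT \<rightarrow>\<^sub>t BoolT)" "ren_tm r less_tm = less_tm" "sub_tm s less_tm = less_tm"
  by (simp_all add: less_tm_def positive_tm_def monus_tm_def pred_tm_def up_sub_scons)

lemma prepend_closed [simp]:
  "tyof \<Gamma> (prepend X) = Some (X \<rightarrow>\<^sub>t (NatT \<rightarrow>\<^sub>t X) \<rightarrow>\<^sub>t NatT \<rightarrow>\<^sub>t X)"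
  "ren_tm r (prepend X) = prepend X" "sub_tm s (prepend X) = prepend X"
  by (simp_all add: prepend_def up_sub_scons)

lemma section_closed [simp]:
  "tyof \<Gamma> (section_at X R) = Some (((NatT \<rightarrow>\<^sub>t X) \<rightarrow>\<^sub>t R) \<rightarrow>\<^sub>t X \<rightarrow>\<^sub>t (NatT \<rightarrow>\<^sub>t X) \<rightarrow>\<^sub>t R)"
  "ren_tm r (section_at X R) = section_at X R" "sub_tm s (section_at X R) = section_at X R"
  by (simp_all add: section_at_def up_sub_scons)

section \<open>The combinators of the construction\<close>

abbreviation seqt :: "ty \<Rightarrow> ty" where "seqt X \<equiv> NatT \<rightarrow>\<^sub>t X"
abbreviation cntt :: "ty \<Rightarrow> ty" where "cntt X \<equiv> seqt X \<rightarrow>\<^sub>t NatT \<rightarrow>\<^sub>t NatT"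
abbreviation valt :: "ty \<Rightarrow> ty" where "valt X \<equiv> seqt X \<times>\<^sub>t cntt X"
abbreviation fstv :: "ty \<Rightarrow> tm" where "fstv X \<equiv> Const (FstC (seqt X) (cntt X))"
abbreviation sndv :: "ty \<Rightarrow> tm" where "sndv X \<equiv> Const (SndC (seqt X) (cntt X))"

text \<open>The first component of an element of \<open>valt X\<close> is a play; the second maps \<alpha> and j to the
  number of steps the recursion makes when it is continued along \<alpha> from position j.\<close>

definition tail_value :: "ty \<Rightarrow> ty \<Rightarrow> tm" where
  "tail_value X R = Lam (seqt X \<rightarrow>\<^sub>t R) (Lam (X \<rightarrow>\<^sub>t valt X) (Lam X
     (Var 2 \<cdot> (fstv X \<cdot> (Var 1 \<cdot> Var 0)))))"

text \<open>One step of the count: the move alpha(j) is made, and the count goes on along alpha from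
  position j + 1.\<close>

definition tick :: "ty \<Rightarrow> tm" where
  "tick X = Lam (X \<rightarrow>\<^sub>t valt X) (Lam (seqt X) (Lam NatT
     (Succ (sndv X \<cdot> (Var 2 \<cdot> (Var 1 \<cdot> Var 0)) \<cdot> Var 1 \<cdot> Succ (Var 0)))))"

definition quant :: "ty \<Rightarrow> ty \<Rightarrow> tm" where
  "quant X R = Lam (NatT \<rightarrow>\<^sub>t J R X) (Lam (seqt X \<rightarrow>\<^sub>t R) (Lam NatT (Lam (X \<rightarrow>\<^sub>t valt X)
     (MkPair (seqt X) (cntt X)
        (fstv X \<cdot> (Var 0 \<cdot> (Var 3 \<cdot> Var 1 \<cdot> (tail_value X R \<cdot> Var 2 \<cdot> Var 0))))
        (tick X \<cdot> Var 0)))))"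

text \<open>Applied to \<open>outcome\<close> of G at the zero sequence it gives l(q(G(0))), so epq
  with this control makes the stopping test of eps.\<close>

definition ctrl :: "ty \<Rightarrow> ty \<Rightarrow> tm" where
  "ctrl X R = Lam (R \<rightarrow>\<^sub>t NatT) (Lam (seqt X \<rightarrow>\<^sub>t R) (Lam (valt X)
     (Var 2 \<cdot> (Var 1 \<cdot> (fstv X \<cdot> Var 0)))))"

text \<open>The first argument stores the moves made so far, as the map from a tail to the play
  extended by it. The count starts at zero, for no step remains when the recursion stops.\<close>

definition outcome :: "ty \<Rightarrow> tm" where
  "outcome X = Lam (seqt X \<rightarrow>\<^sub>t seqt X) (Lam (seqt X)
     (MkPair (seqt X) (cntt X) (Var 1 \<cdot> Var 0) (zero (cntt X))))"

definition ident :: "ty \<Rightarrow> tm" where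
  "ident X = Lam (seqt X) (Var 0)"

definition compose :: "ty \<Rightarrow> tm" where
  "compose X = Lam (seqt X \<rightarrow>\<^sub>t seqt X) (Lam (seqt X \<rightarrow>\<^sub>t seqt X) (Lam (seqt X)
     (Var 2 \<cdot> (Var 1 \<cdot> Var 0))))"

text \<open>Sequences grow at the end, so the last entry is the first to be put in front of the
  tail: after(s * y)(beta) = after(s)(y * beta).\<close>

definition section_step :: "ty \<Rightarrow> tm" where
  "section_step X = Lam (SeqT X) (Lam X (Lam (seqt X \<rightarrow>\<^sub>t seqt X)
     (section_at X (seqt X) \<cdot> Var 0 \<cdot> Var 1)))"

definition succ_step :: "ty \<Rightarrow> tm" where
  "succ_step X = Lam (SeqT X) (Lam X (Lam NatT (Succ (Var 0))))"

text \<open>\<open>after X s\<close> maps \<beta> to s * \<beta>, and \<open>position X n s\<close> is n plus the length of s.\<close>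

abbreviation after :: "ty \<Rightarrow> tm \<Rightarrow> tm" where
  "after X s \<equiv> SeqRec X (seqt X \<rightarrow>\<^sub>t seqt X) (ident X) (section_step X) s"

abbreviation position :: "ty \<Rightarrow> tm \<Rightarrow> tm \<Rightarrow> tm" where
  "position X n s \<equiv> SeqRec X NatT n (succ_step X) s"

text \<open>Closed form of the abstraction in the equation of epq: the values of the recursive calls
  as a function of the next move.\<close>

definition next_values :: "ty \<Rightarrow> ty \<Rightarrow> tm" where
  "next_values X R = Lam (epq_type X R) (Lam (R \<rightarrow>\<^sub>t NatT) (Lam NatT (Lam (NatT \<rightarrow>\<^sub>t K R X)
     (Lam (seqt X \<rightarrow>\<^sub>t R) (Lam X
       (Var 5 \<cdot> Var 4 \<cdot> Succ (Var 3) \<cdot> Var 2 \<cdot> (section_at X R \<cdot> Var 1 \<cdot> Var 0)))))))"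

text \<open>The witness. Only moves from position n on are recorded, so the recursion starts with
  the empty list of moves, that is with \<open>ident\<close>.\<close>

definition eps_of_epq :: "ty \<Rightarrow> ty \<Rightarrow> tm" where
  "eps_of_epq X R = Lam (epq_type X (valt X)) (Lam (R \<rightarrow>\<^sub>t NatT) (Lam NatT
     (Lam (NatT \<rightarrow>\<^sub>t J R X) (Lam (seqt X \<rightarrow>\<^sub>t R)
       (fstv X \<cdot> (Var 4 \<cdot> (ctrl X R \<cdot> Var 3 \<cdot> Var 0) \<cdot> Var 2 \<cdot> (quant X R \<cdot> Var 1 \<cdot> Var 0)
          \<cdot> (outcome X \<cdot> ident X)))))))"

text \<open>Here n is the position of the first entry of s, and x has been played just before it.
  For the equation of eps at n, this is therefore needed at \<open>Succ\<close> n.\<close>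

definition value_left :: "ty \<Rightarrow> ty \<Rightarrow> tm" where
  "value_left X R = Lam (epq_type X (valt X)) (Lam (R \<rightarrow>\<^sub>t NatT) (Lam NatT
     (Lam (NatT \<rightarrow>\<^sub>t J R X) (Lam (seqt X \<rightarrow>\<^sub>t R) (Lam X (Lam (SeqT X)
       (Var 6 \<cdot> (ctrl X R \<cdot> Var 5 \<cdot> Var 2) \<cdot> position X (Var 4) (Var 0)
          \<cdot> (quant X R \<cdot> Var 3 \<cdot> Var 2)
          \<cdot> (outcome X \<cdot> (compose X \<cdot> (prepend X \<cdot> Var 1) \<cdot> after X (Var 0))))))))))"

text \<open>The two sides of the identity proved by bar induction, as functions of s (the last argument), and
  the condition \<open>secured\<close> under which the recursion stops at s.\<close>

definition left_side :: "ty \<Rightarrow> ty \<Rightarrow> tm" where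
  "left_side X R = Lam (epq_type X (valt X)) (Lam (R \<rightarrow>\<^sub>t NatT) (Lam NatT
     (Lam (NatT \<rightarrow>\<^sub>t J R X) (Lam (seqt X \<rightarrow>\<^sub>t R) (Lam X (Lam (SeqT X)
       (fstv X \<cdot> (value_left X R \<cdot> Var 6 \<cdot> Var 5 \<cdot> Var 4 \<cdot> Var 3 \<cdot> Var 2 \<cdot> Var 1 \<cdot> Var 0))))))))"

definition right_side :: "ty \<Rightarrow> ty \<Rightarrow> tm" where
  "right_side X R = Lam (epq_type X (valt X)) (Lam (R \<rightarrow>\<^sub>t NatT) (Lam NatT
     (Lam (NatT \<rightarrow>\<^sub>t J R X) (Lam (seqt X \<rightarrow>\<^sub>t R) (Lam X (Lam (SeqT X)
       (prepend X \<cdot> Var 1 \<cdot> (fstv X \<cdot> (Var 6 \<cdot> (ctrl X R \<cdot> Var 5 \<cdot> (section_at X R \<cdot> Var 2 \<cdot> Var 1))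
          \<cdot> position X (Var 4) (Var 0) \<cdot> (quant X R \<cdot> Var 3 \<cdot> (section_at X R \<cdot> Var 2 \<cdot> Var 1))
          \<cdot> (outcome X \<cdot> after X (Var 0)))))))))))"

definition secured :: "ty \<Rightarrow> ty \<Rightarrow> tm" where
  "secured X R = Lam (R \<rightarrow>\<^sub>t NatT) (Lam NatT (Lam (seqt X \<rightarrow>\<^sub>t R) (Lam X (Lam (SeqT X)
     (less_tm \<cdot> (Var 4 \<cdot> (Var 2 \<cdot> (prepend X \<cdot> Var 1 \<cdot> (after X (Var 0) \<cdot> zero (seqt X)))))
        \<cdot> position X (Var 3) (Var 0))))))"

text \<open>For fixed alpha this is the function g of Howard's argument. The last argument is both
  the length of the segment already played and the place from which alpha is followed.\<close>

definition counter :: "ty \<Rightarrow> ty \<Rightarrow> tm" where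
  "counter X R = Lam (epq_type X (valt X)) (Lam (R \<rightarrow>\<^sub>t NatT) (Lam NatT
     (Lam (NatT \<rightarrow>\<^sub>t J R X) (Lam (seqt X \<rightarrow>\<^sub>t R) (Lam X (Lam (seqt X) (Lam NatT
       (sndv X \<cdot> (value_left X R \<cdot> Var 7 \<cdot> Var 6 \<cdot> Var 5 \<cdot> Var 4 \<cdot> Var 3 \<cdot> Var 2
          \<cdot> (segment X \<cdot> Var 1 \<cdot> Var 0)) \<cdot> Var 1 \<cdot> Var 0))))))))"

section \<open>Types and closedness of the combinators\<close>

lemma tail_value_closed [simp]:
  "tyof \<Gamma> (tail_value X R) = Some ((seqt X \<rightarrow>\<^sub>t R) \<rightarrow>\<^sub>t (X \<rightarrow>\<^sub>t valt X) \<rightarrow>\<^sub>t X \<rightarrow>\<^sub>t R)"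
  "ren_tm r (tail_value X R) = tail_value X R" "sub_tm s (tail_value X R) = tail_value X R"
  by (simp_all add: tail_value_def up_sub_scons)

lemma tick_closed [simp]:
  "tyof \<Gamma> (tick X) = Some ((X \<rightarrow>\<^sub>t valt X) \<rightarrow>\<^sub>t cntt X)"
  "ren_tm r (tick X) = tick X" "sub_tm s (tick X) = tick X"
  by (simp_all add: tick_def up_sub_scons)

lemma quant_closed [simp]:
  "tyof \<Gamma> (quant X R) = Some ((NatT \<rightarrow>\<^sub>t J R X) \<rightarrow>\<^sub>t (seqt X \<rightarrow>\<^sub>t R) \<rightarrow>\<^sub>t NatT \<rightarrow>\<^sub>t K (valt X) X)"
  "ren_tm r (quant X R) = quant X R" "sub_tm s (quant X R) = quant X R"
  by (simp_all add: quant_def up_sub_scons)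

lemma ctrl_closed [simp]:
  "tyof \<Gamma> (ctrl X R) = Some ((R \<rightarrow>\<^sub>t NatT) \<rightarrow>\<^sub>t (seqt X \<rightarrow>\<^sub>t R) \<rightarrow>\<^sub>t valt X \<rightarrow>\<^sub>t NatT)"
  "ren_tm r (ctrl X R) = ctrl X R" "sub_tm s (ctrl X R) = ctrl X R"
  by (simp_all add: ctrl_def up_sub_scons)

lemma outcome_closed [simp]:
  "tyof \<Gamma> (outcome X) = Some ((seqt X \<rightarrow>\<^sub>t seqt X) \<rightarrow>\<^sub>t seqt X \<rightarrow>\<^sub>t valt X)"
  "ren_tm r (outcome X) = outcome X" "sub_tm s (outcome X) = outcome X"
  by (simp_all add: outcome_def up_sub_scons)

lemma ident_closed [simp]:
  "tyof \<Gamma> (ident X) = Some (seqt X \<rightarrow>\<^sub>t seqt X)"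
  "ren_tm r (ident X) = ident X" "sub_tm s (ident X) = ident X"
  by (simp_all add: ident_def up_sub_scons)

lemma compose_closed [simp]:
  "tyof \<Gamma> (compose X) = Some ((seqt X \<rightarrow>\<^sub>t seqt X) \<rightarrow>\<^sub>t (seqt X \<rightarrow>\<^sub>t seqt X) \<rightarrow>\<^sub>t seqt X \<rightarrow>\<^sub>t seqt X)"
  "ren_tm r (compose X) = compose X" "sub_tm s (compose X) = compose X"
  by (simp_all add: compose_def up_sub_scons)

lemma section_step_closed [simp]:
  "tyof \<Gamma> (section_step X) = Some (SeqT X \<rightarrow>\<^sub>t X \<rightarrow>\<^sub>t (seqt X \<rightarrow>\<^sub>t seqt X) \<rightarrow>\<^sub>t seqt X \<rightarrow>\<^sub>t seqt X)"
  "ren_tm r (section_step X) = section_step X" "sub_tm s (section_step X) = section_step X"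
  by (simp_all add: section_step_def up_sub_scons)

lemma succ_step_closed [simp]:
  "tyof \<Gamma> (succ_step X) = Some (SeqT X \<rightarrow>\<^sub>t X \<rightarrow>\<^sub>t NatT \<rightarrow>\<^sub>t NatT)"
  "ren_tm r (succ_step X) = succ_step X" "sub_tm s (succ_step X) = succ_step X"
  by (simp_all add: succ_step_def up_sub_scons)

lemma next_values_closed [simp]:
  "tyof \<Gamma> (next_values X R) = Some (epq_type X R \<rightarrow>\<^sub>t (R \<rightarrow>\<^sub>t NatT) \<rightarrow>\<^sub>t NatT
     \<rightarrow>\<^sub>t (NatT \<rightarrow>\<^sub>t K R X) \<rightarrow>\<^sub>t (seqt X \<rightarrow>\<^sub>t R) \<rightarrow>\<^sub>t X \<rightarrow>\<^sub>t R)"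
  "ren_tm r (next_values X R) = next_values X R" "sub_tm s (next_values X R) = next_values X R"
  by (simp_all add: next_values_def up_sub_scons)

lemma eps_of_epq_closed [simp]:
  "tyof \<Gamma> (eps_of_epq X R) = Some (epq_type X (valt X) \<rightarrow>\<^sub>t eps_type X R)"
  "ren_tm r (eps_of_epq X R) = eps_of_epq X R" "sub_tm s (eps_of_epq X R) = eps_of_epq X R"
  by (simp_all add: eps_of_epq_def up_sub_scons)

lemma value_left_closed [simp]:
  "tyof \<Gamma> (value_left X R) = Some (epq_type X (valt X) \<rightarrow>\<^sub>t (R \<rightarrow>\<^sub>t NatT) \<rightarrow>\<^sub>t NatT
     \<rightarrow>\<^sub>t (NatT \<rightarrow>\<^sub>t J R X) \<rightarrow>\<^sub>t (seqt X \<rightarrow>\<^sub>t R) \<rightarrow>\<^sub>t X \<rightarrow>\<^sub>t SeqT X \<rightarrow>\<^sub>t valt X)"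
  "ren_tm r (value_left X R) = value_left X R" "sub_tm s (value_left X R) = value_left X R"
  by (simp_all add: value_left_def up_sub_scons)

lemma left_side_closed [simp]:
  "tyof \<Gamma> (left_side X R) = Some (epq_type X (valt X) \<rightarrow>\<^sub>t (R \<rightarrow>\<^sub>t NatT) \<rightarrow>\<^sub>t NatT
     \<rightarrow>\<^sub>t (NatT \<rightarrow>\<^sub>t J R X) \<rightarrow>\<^sub>t (seqt X \<rightarrow>\<^sub>t R) \<rightarrow>\<^sub>t X \<rightarrow>\<^sub>t SeqT X \<rightarrow>\<^sub>t seqt X)"
  "ren_tm r (left_side X R) = left_side X R" "sub_tm s (left_side X R) = left_side X R"
  by (simp_all add: left_side_def up_sub_scons)

lemma right_side_closed [simp]:
  "tyof \<Gamma> (right_side X R) = Some (epq_type X (valt X) \<rightarrow>\<^sub>t (R \<rightarrow>\<^sub>t NatT) \<rightarrow>\<^sub>t NatT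
     \<rightarrow>\<^sub>t (NatT \<rightarrow>\<^sub>t J R X) \<rightarrow>\<^sub>t (seqt X \<rightarrow>\<^sub>t R) \<rightarrow>\<^sub>t X \<rightarrow>\<^sub>t SeqT X \<rightarrow>\<^sub>t seqt X)"
  "ren_tm r (right_side X R) = right_side X R" "sub_tm s (right_side X R) = right_side X R"
  by (simp_all add: right_side_def up_sub_scons)

lemma secured_closed [simp]:
  "tyof \<Gamma> (secured X R) = Some ((R \<rightarrow>\<^sub>t NatT) \<rightarrow>\<^sub>t NatT \<rightarrow>\<^sub>t (seqt X \<rightarrow>\<^sub>t R) \<rightarrow>\<^sub>t X \<rightarrow>\<^sub>t SeqT X \<rightarrow>\<^sub>t BoolT)"
  "ren_tm r (secured X R) = secured X R" "sub_tm s (secured X R) = secured X R"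
  by (simp_all add: secured_def up_sub_scons)

lemma counter_closed [simp]:
  "tyof \<Gamma> (counter X R) = Some (epq_type X (valt X) \<rightarrow>\<^sub>t (R \<rightarrow>\<^sub>t NatT) \<rightarrow>\<^sub>t NatT
     \<rightarrow>\<^sub>t (NatT \<rightarrow>\<^sub>t J R X) \<rightarrow>\<^sub>t (seqt X \<rightarrow>\<^sub>t R) \<rightarrow>\<^sub>t X \<rightarrow>\<^sub>t seqt X \<rightarrow>\<^sub>t NatT \<rightarrow>\<^sub>t NatT)"
  "ren_tm r (counter X R) = counter X R" "sub_tm s (counter X R) = counter X R"
  by (simp_all add: counter_def up_sub_scons)

section \<open>Application equations of the combinators on classes\<close>

context HA_context
begin

lemma section_at_app [simp]:
  assumes "tc Q = Some (seqt X \<rightarrow>\<^sub>t R)" "tc Y = Some X" "tc B = Some (seqt X)"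
  shows "cls (section_at X R) \<bullet> Q \<bullet> Y \<bullet> B = Q \<bullet> (cls (prepend X) \<bullet> Y \<bullet> B)"
  using assms by (elim tcE) (simp add: section_at_def up_sub_scons)

lemma tail_value_app [simp]:
  assumes "tc Q = Some (seqt X \<rightarrow>\<^sub>t R)" "tc F = Some (X \<rightarrow>\<^sub>t valt X)" "tc Y = Some X"
  shows "cls (tail_value X R) \<bullet> Q \<bullet> F \<bullet> Y = Q \<bullet> (cls (fstv X) \<bullet> (F \<bullet> Y))"
  using assms by (elim tcE) (simp add: tail_value_def up_sub_scons)

lemma tick_app [simp]:
  assumes "tc F = Some (X \<rightarrow>\<^sub>t valt X)" "tc A = Some (seqt X)" "tc N = Some NatT"
  shows "cls (tick X) \<bullet> F \<bullet> A \<bullet> N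
    = cls (Const SuccC) \<bullet> (cls (sndv X) \<bullet> (F \<bullet> (A \<bullet> N)) \<bullet> A \<bullet> (cls (Const SuccC) \<bullet> N))"
  using assms by (elim tcE) (simp add: tick_def up_sub_scons)

lemma quant_app [simp]:
  assumes "tc E = Some (NatT \<rightarrow>\<^sub>t J R X)" "tc Q = Some (seqt X \<rightarrow>\<^sub>t R)" "tc N = Some NatT"
    "tc F = Some (X \<rightarrow>\<^sub>t valt X)"
  shows "cls (quant X R) \<bullet> E \<bullet> Q \<bullet> N \<bullet> F = cls (Const (PairC (seqt X) (cntt X)))
     \<bullet> (cls (fstv X) \<bullet> (F \<bullet> (E \<bullet> N \<bullet> (cls (tail_value X R) \<bullet> Q \<bullet> F))))
     \<bullet> (cls (tick X) \<bullet> F)"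
  using assms by (elim tcE) (simp add: quant_def up_sub_scons)

lemma ctrl_app [simp]:
  assumes "tc L = Some (R \<rightarrow>\<^sub>t NatT)" "tc Q = Some (seqt X \<rightarrow>\<^sub>t R)" "tc V = Some (valt X)"
  shows "cls (ctrl X R) \<bullet> L \<bullet> Q \<bullet> V = L \<bullet> (Q \<bullet> (cls (fstv X) \<bullet> V))"
  using assms by (elim tcE) (simp add: ctrl_def up_sub_scons)

lemma outcome_app [simp]:
  assumes "tc F = Some (seqt X \<rightarrow>\<^sub>t seqt X)" "tc B = Some (seqt X)"
  shows "cls (outcome X) \<bullet> F \<bullet> B
    = cls (Const (PairC (seqt X) (cntt X))) \<bullet> (F \<bullet> B) \<bullet> cls (zero (cntt X))"
  using assms by (elim tcE) (simp add: outcome_def up_sub_scons del: zero.simps)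

lemma ident_app [simp]:
  assumes "tc B = Some (seqt X)"
  shows "cls (ident X) \<bullet> B = B"
  using assms by (elim tcE) (simp add: ident_def up_sub_scons)

lemma compose_app [simp]:
  assumes "tc F = Some (seqt X \<rightarrow>\<^sub>t seqt X)" "tc G = Some (seqt X \<rightarrow>\<^sub>t seqt X)" "tc B = Some (seqt X)"
  shows "cls (compose X) \<bullet> F \<bullet> G \<bullet> B = F \<bullet> (G \<bullet> B)"
  using assms by (elim tcE) (simp add: compose_def up_sub_scons)

lemma section_step_app [simp]:
  assumes "tc S = Some (SeqT X)" "tc Y = Some X" "tc F = Some (seqt X \<rightarrow>\<^sub>t seqt X)"
  shows "cls (section_step X) \<bullet> S \<bullet> Y \<bullet> F = cls (section_at X (seqt X)) \<bullet> F \<bullet> Y"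
  using assms by (elim tcE) (simp add: section_step_def up_sub_scons)

lemma succ_step_app [simp]:
  assumes "tc S = Some (SeqT X)" "tc Y = Some X" "tc N = Some NatT"
  shows "cls (succ_step X) \<bullet> S \<bullet> Y \<bullet> N = cls (Const SuccC) \<bullet> N"
  using assms by (elim tcE) (simp add: succ_step_def up_sub_scons)

lemma next_values_app [simp]:
  assumes "tc F = Some (epq_type X R)" "tc L = Some (R \<rightarrow>\<^sub>t NatT)" "tc N = Some NatT"
    "tc P = Some (NatT \<rightarrow>\<^sub>t K R X)" "tc Q = Some (seqt X \<rightarrow>\<^sub>t R)" "tc Y = Some X"
  shows "cls (next_values X R) \<bullet> F \<bullet> L \<bullet> N \<bullet> P \<bullet> Q \<bullet> Y
    = F \<bullet> L \<bullet> (cls (Const SuccC) \<bullet> N) \<bullet> P \<bullet> (cls (section_at X R) \<bullet> Q \<bullet> Y)"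
  using assms by (elim tcE) (simp add: next_values_def up_sub_scons)

lemma eps_of_epq_app [simp]:
  assumes "tc F = Some (epq_type X (valt X))" "tc L = Some (R \<rightarrow>\<^sub>t NatT)" "tc N = Some NatT"
    "tc E = Some (NatT \<rightarrow>\<^sub>t J R X)" "tc Q = Some (seqt X \<rightarrow>\<^sub>t R)"
  shows "cls (eps_of_epq X R) \<bullet> F \<bullet> L \<bullet> N \<bullet> E \<bullet> Q
    = cls (fstv X) \<bullet> (F \<bullet> (cls (ctrl X R) \<bullet> L \<bullet> Q) \<bullet> N \<bullet> (cls (quant X R) \<bullet> E \<bullet> Q)
          \<bullet> (cls (outcome X) \<bullet> cls (ident X)))"
  using assms by (elim tcE) (simp add: eps_of_epq_def up_sub_scons)

end

declare zero.simps [simp del]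

text \<open>The functional is the only free variable of the equation, so a constant substitution
  places any term there, in any context. This form commutes with lifting.\<close>

definition epq_at :: "ty \<Rightarrow> ty \<Rightarrow> tm \<Rightarrow> fm" where
  "epq_at X R F = sub_fm (\<lambda>_. F) (epq_equation X R)"

lemma lift_epq_at [simp]: "lift_fm (epq_at X R F) = epq_at X R (lift_tm F)"
  by (simp add: epq_at_def ren_sub_fm comp_def del: sub_ren_comp)

lemma wf_epq_at:
  assumes "tyof \<Gamma> F = Some (epq_type X R)"
  shows "wf_fm \<Gamma> (epq_at X R F)"
  using assms by (simp add: epq_at_def epq_equation_def Let_def up_sub_scons has_type_iff)

context HA_context
begin

lemma value_left_app:
  assumes "tc F = Some (epq_type X (valt X))" "tc L = Some (R \<rightarrow>\<^sub>t NatT)" "tc N = Some NatT"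
    "tc E = Some (NatT \<rightarrow>\<^sub>t J R X)" "tc Q = Some (seqt X \<rightarrow>\<^sub>t R)" "tc Y = Some X" "tc S = Some (SeqT X)"
  shows "cls (value_left X R) \<bullet> F \<bullet> L \<bullet> N \<bullet> E \<bullet> Q \<bullet> Y \<bullet> S
    = F \<bullet> (cls (ctrl X R) \<bullet> L \<bullet> Q)
      \<bullet> (cls (Const (SeqRecC X NatT)) \<bullet> N \<bullet> cls (succ_step X) \<bullet> S)
      \<bullet> (cls (quant X R) \<bullet> E \<bullet> Q)
      \<bullet> (cls (outcome X) \<bullet> (cls (compose X) \<bullet> (cls (prepend X) \<bullet> Y)
          \<bullet> (cls (Const (SeqRecC X (seqt X \<rightarrow>\<^sub>t seqt X))) \<bullet> cls (ident X) \<bullet> cls (section_step X) \<bullet> S)))"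
  using assms by (elim tcE) (simp add: value_left_def up_sub_scons)

lemma left_side_app [simp]:
  assumes "tc F = Some (epq_type X (valt X))" "tc L = Some (R \<rightarrow>\<^sub>t NatT)" "tc N = Some NatT"
    "tc E = Some (NatT \<rightarrow>\<^sub>t J R X)" "tc Q = Some (seqt X \<rightarrow>\<^sub>t R)" "tc Y = Some X" "tc S = Some (SeqT X)"
  shows "cls (left_side X R) \<bullet> F \<bullet> L \<bullet> N \<bullet> E \<bullet> Q \<bullet> Y \<bullet> S
    = cls (fstv X) \<bullet> (cls (value_left X R) \<bullet> F \<bullet> L \<bullet> N \<bullet> E \<bullet> Q \<bullet> Y \<bullet> S)"
  using assms by (elim tcE) (simp add: left_side_def up_sub_scons)

lemma right_side_app [simp]:
  assumes "tc F = Some (epq_type X (valt X))" "tc L = Some (R \<rightarrow>\<^sub>t NatT)" "tc N = Some NatT"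
    "tc E = Some (NatT \<rightarrow>\<^sub>t J R X)" "tc Q = Some (seqt X \<rightarrow>\<^sub>t R)" "tc Y = Some X" "tc S = Some (SeqT X)"
  shows "cls (right_side X R) \<bullet> F \<bullet> L \<bullet> N \<bullet> E \<bullet> Q \<bullet> Y \<bullet> S
    = cls (prepend X) \<bullet> Y \<bullet> (cls (fstv X) \<bullet> (F \<bullet> (cls (ctrl X R) \<bullet> L \<bullet> (cls (section_at X R) \<bullet> Q \<bullet> Y))
      \<bullet> (cls (Const (SeqRecC X NatT)) \<bullet> N \<bullet> cls (succ_step X) \<bullet> S)
      \<bullet> (cls (quant X R) \<bullet> E \<bullet> (cls (section_at X R) \<bullet> Q \<bullet> Y))
      \<bullet> (cls (outcome X)
          \<bullet> (cls (Const (SeqRecC X (seqt X \<rightarrow>\<^sub>t seqt X))) \<bullet> cls (ident X) \<bullet> cls (section_step X) \<bullet> S))))"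
  using assms by (elim tcE) (simp add: right_side_def up_sub_scons)

lemma secured_app [simp]:
  assumes "tc L = Some (R \<rightarrow>\<^sub>t NatT)" "tc N = Some NatT" "tc Q = Some (seqt X \<rightarrow>\<^sub>t R)" "tc Y = Some X"
    "tc S = Some (SeqT X)"
  shows "cls (secured X R) \<bullet> L \<bullet> N \<bullet> Q \<bullet> Y \<bullet> S
    = cls less_tm \<bullet> (L \<bullet> (Q \<bullet> (cls (prepend X) \<bullet> Y
      \<bullet> (cls (Const (SeqRecC X (seqt X \<rightarrow>\<^sub>t seqt X))) \<bullet> cls (ident X) \<bullet> cls (section_step X) \<bullet> S
         \<bullet> cls (zero (seqt X))))))
      \<bullet> (cls (Const (SeqRecC X NatT)) \<bullet> N \<bullet> cls (succ_step X) \<bullet> S)"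
  using assms by (elim tcE) (simp add: secured_def up_sub_scons)

lemma counter_app [simp]:
  assumes "tc F = Some (epq_type X (valt X))" "tc L = Some (R \<rightarrow>\<^sub>t NatT)" "tc N = Some NatT"
    "tc E = Some (NatT \<rightarrow>\<^sub>t J R X)" "tc Q = Some (seqt X \<rightarrow>\<^sub>t R)" "tc Y = Some X"
    "tc A = Some (seqt X)" "tc I = Some NatT"
  shows "cls (counter X R) \<bullet> F \<bullet> L \<bullet> N \<bullet> E \<bullet> Q \<bullet> Y \<bullet> A \<bullet> I
    = cls (sndv X) \<bullet> (cls (value_left X R) \<bullet> F \<bullet> L \<bullet> N \<bullet> E \<bullet> Q \<bullet> Y \<bullet> (cls (segment X) \<bullet> A \<bullet> I))
      \<bullet> A \<bullet> I"
  using assms by (elim tcE) (simp add: counter_def up_sub_scons)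

lemma segment_Succ [simp]:
  assumes "tc A = Some (seqt X)" "tc N = Some NatT"
  shows "cls (segment X) \<bullet> A \<bullet> (cls (Const SuccC) \<bullet> N)
    = cls (Const (SnocC X)) \<bullet> (cls (segment X) \<bullet> A \<bullet> N) \<bullet> (A \<bullet> N)"
proof -
  from assms obtain a n where a [simp]: "A = cls a" "tyof \<Gamma> a = Some (seqt X)"
    and n [simp]: "N = cls n" "tyof \<Gamma> n = Some NatT" by (elim tcE)
  \<comment> \<open>After beta reduction the step function of the recursor contains the lifted
    sequence under its binders. Naming it makes the calls at \<open>n\<close> and at its successor
    share one function.\<close>
  let ?f = "Lam NatT (Lam (SeqT X) (Snoc X (Var 0) (lift_tm (lift_tm a) \<cdot> Var 1)))"
  have seg: "cls (segment X) \<bullet> A \<bullet> cls k = cls (Const (RecC (SeqT X))) \<bullet> cls (Empty X) \<bullet> cls ?f \<bullet> cls k"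
    if "tyof \<Gamma> k = Some NatT" for k
    using that by (simp add: segment_def up_sub_scons)
  have f: "cls ?f \<bullet> cls n \<bullet> S = cls (Const (SnocC X)) \<bullet> S \<bullet> (A \<bullet> N)" if "tc S = Some (SeqT X)" for S
    using that by (elim tcE) (simp add: up_sub_scons)
  show ?thesis using seg[of n] seg[of "Succ n"] f by simp
qed

text \<open>The defining equation as an equation of classes. Extensionality identifies its inner
  abstraction with \<open>next_values\<close>, after which only applications remain.\<close>

lemma epq_eq:
  assumes "epq_at X R f \<in> H" "tyof \<Gamma> f = Some (epq_type X R)"
    and "tc L = Some (R \<rightarrow>\<^sub>t NatT)" "tc N = Some NatT" "tc P = Some (NatT \<rightarrow>\<^sub>t K R X)"
      "tc Q = Some (seqt X \<rightarrow>\<^sub>t R)"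
  shows "cls f \<bullet> L \<bullet> N \<bullet> P \<bullet> Q = cls (Const (CondC R))
      \<bullet> (cls less_tm \<bullet> (L \<bullet> (Q \<bullet> cls (zero (seqt X)))) \<bullet> N) \<bullet> (Q \<bullet> cls (zero (seqt X)))
      \<bullet> (P \<bullet> N \<bullet> (cls (next_values X R) \<bullet> cls f \<bullet> L \<bullet> N \<bullet> P \<bullet> Q))"
proof -
  note [simp] = assms(2) has_type_iff
  from assms obtain l n p q where [simp]: "L = cls l" "N = cls n" "P = cls p" "Q = cls q"
    "tyof \<Gamma> l = Some (R \<rightarrow>\<^sub>t NatT)" "tyof \<Gamma> n = Some NatT" "tyof \<Gamma> p = Some (NatT \<rightarrow>\<^sub>t K R X)"
    "tyof \<Gamma> q = Some (seqt X \<rightarrow>\<^sub>t R)" by (elim tcE)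
  let ?next = "Lam X (lift_tm f \<cdot> lift_tm l \<cdot> Succ (lift_tm n) \<cdot> lift_tm p
    \<cdot> (section_at X R \<cdot> lift_tm q \<cdot> Var 0))"
  let ?rhs = "Cond R (less_tm \<cdot> (l \<cdot> (q \<cdot> zero (seqt X))) \<cdot> n) (q \<cdot> zero (seqt X)) (p \<cdot> n \<cdot> ?next)"
  have "T; \<Gamma>; H \<turnstile> sub_fm (\<lambda>_. f) (epq_equation X R)"
    using prv.assm[OF assms(1) wf_epq_at] by (simp add: epq_at_def)
  from AllE_sub[OF AllE_sub[OF AllE_sub[OF AllE_sub[OF
    this[unfolded epq_equation_def], of l], of n], of p], of q]
  have "T; \<Gamma>; H \<turnstile> Eq R (f \<cdot> l \<cdot> n \<cdot> p \<cdot> q) ?rhs"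
    by (simp add: Let_def up_sub_scons)
  then have "cls (f \<cdot> l \<cdot> n \<cdot> p \<cdot> q) = cls ?rhs" by (rule cls_eqI) simp_all
  moreover have "cls ?next = cls (next_values X R \<cdot> f \<cdot> l \<cdot> n \<cdot> p \<cdot> q)"
  proof (rule cls_ext)
    interpret U: HA_context T "X # \<Gamma>" "lift_fm ` H" by (rule HA_context_T)
    show "U.cls (lift_tm ?next \<cdot> Var 0) = U.cls (lift_tm (next_values X R \<cdot> f \<cdot> l \<cdot> n \<cdot> p \<cdot> q) \<cdot> Var 0)"
      by simp
  qed simp_all
  ultimately show ?thesis by simp
qed

text \<open>A further move changes only the stored map, so every functional met in the recursion is
  again an \<open>outcome\<close>. The next lemmas compute the changed map.\<close>

lemma section_outcome [simp]:
  assumes "tc G = Some (seqt X \<rightarrow>\<^sub>t seqt X)" "tc Y = Some X"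
  shows "cls (section_at X (valt X)) \<bullet> (cls (outcome X) \<bullet> G) \<bullet> Y
    = cls (outcome X) \<bullet> (cls (section_at X (seqt X)) \<bullet> G \<bullet> Y)"
proof -
  from assms obtain g y where [simp]: "G = cls g" "Y = cls y"
    "tyof \<Gamma> g = Some (seqt X \<rightarrow>\<^sub>t seqt X)" "tyof \<Gamma> y = Some X" by (elim tcE)
  interpret U: HA_context T "seqt X # \<Gamma>" "lift_fm ` H" by (rule HA_context_T)
  have "cls (section_at X (valt X) \<cdot> (outcome X \<cdot> g) \<cdot> y)
    = cls (outcome X \<cdot> (section_at X (seqt X) \<cdot> g \<cdot> y))"
    by (rule cls_ext[where \<sigma> = "seqt X"]) simp_all
  then show ?thesis by simp
qed

lemma section_compose [simp]:
  assumes "tc F = Some (seqt X \<rightarrow>\<^sub>t seqt X)" "tc G = Some (seqt X \<rightarrow>\<^sub>t seqt X)" "tc Y = Some X"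
  shows "cls (section_at X (seqt X)) \<bullet> (cls (compose X) \<bullet> F \<bullet> G) \<bullet> Y
    = cls (compose X) \<bullet> F \<bullet> (cls (section_at X (seqt X)) \<bullet> G \<bullet> Y)"
proof -
  from assms obtain f g y where [simp]: "F = cls f" "G = cls g" "Y = cls y"
    "tyof \<Gamma> f = Some (seqt X \<rightarrow>\<^sub>t seqt X)" "tyof \<Gamma> g = Some (seqt X \<rightarrow>\<^sub>t seqt X)"
    "tyof \<Gamma> y = Some X" by (elim tcE)
  interpret U: HA_context T "seqt X # \<Gamma>" "lift_fm ` H" by (rule HA_context_T)
  have "cls (section_at X (seqt X) \<cdot> (compose X \<cdot> f \<cdot> g) \<cdot> y)
    = cls (compose X \<cdot> f \<cdot> (section_at X (seqt X) \<cdot> g \<cdot> y))"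
    by (rule cls_ext[where \<sigma> = "seqt X"]) simp_all
  then show ?thesis by simp
qed

lemma section_ident [simp]:
  assumes "tc Y = Some X"
  shows "cls (section_at X (seqt X)) \<bullet> cls (ident X) \<bullet> Y = cls (prepend X) \<bullet> Y"
proof -
  from assms obtain y where [simp]: "Y = cls y" "tyof \<Gamma> y = Some X" by (elim tcE)
  interpret U: HA_context T "seqt X # \<Gamma>" "lift_fm ` H" by (rule HA_context_T)
  have "cls (section_at X (seqt X) \<cdot> ident X \<cdot> y) = cls (prepend X \<cdot> y)"
    by (rule cls_ext[where \<sigma> = "seqt X"]) simp_all
  then show ?thesis by simp
qed

lemma compose_ident [simp]:
  assumes "tc F = Some (seqt X \<rightarrow>\<^sub>t seqt X)"
  shows "cls (compose X) \<bullet> F \<bullet> cls (ident X) = F"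
proof -
  from assms obtain f where [simp]: "F = cls f" "tyof \<Gamma> f = Some (seqt X \<rightarrow>\<^sub>t seqt X)" by (elim tcE)
  interpret U: HA_context T "seqt X # \<Gamma>" "lift_fm ` H" by (rule HA_context_T)
  have "cls (compose X \<cdot> f \<cdot> ident X) = cls f"
    by (rule cls_ext[where \<sigma> = "seqt X"]) simp_all
  then show ?thesis by simp
qed

lemma cls_All_Snoc:
  assumes "All X (Eq \<tau> (lift_tm f \<cdot> Snoc X (lift_tm s) (Var 0)) (lift_tm g \<cdot> Snoc X (lift_tm s) (Var 0))) \<in> H"
    and [simp]: "tyof \<Gamma> f = Some (SeqT X \<rightarrow>\<^sub>t \<tau>)" "tyof \<Gamma> g = Some (SeqT X \<rightarrow>\<^sub>t \<tau>)"
      "tyof \<Gamma> s = Some (SeqT X)"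
    and Y: "tc Y = Some X"
  shows "cls f \<bullet> (cls (Const (SnocC X)) \<bullet> cls s \<bullet> Y) = cls g \<bullet> (cls (Const (SnocC X)) \<bullet> cls s \<bullet> Y)"
proof -
  from Y obtain y where [simp]: "Y = cls y" "tyof \<Gamma> y = Some X" by (elim tcE)
  have "T; \<Gamma>; H \<turnstile> Eq \<tau> (f \<cdot> Snoc X s y) (g \<cdot> Snoc X s y)"
    using AllE_assm[OF assms(1), of \<Gamma> y T] by (simp add: has_type_iff)
  then have "cls (f \<cdot> Snoc X s y) = cls (g \<cdot> Snoc X s y)" by (rule cls_eqI) simp_all
  then show ?thesis by simp
qed

end

section \<open>The recursion of epq along a sequence, and the identity between the two sides\<close>

locale epq_context = HA_context +
  fixes X R :: ty and f l n e q :: tm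
  assumes f_type [simp]: "tyof \<Gamma> f = Some (epq_type X (valt X))"
    and l_type [simp]: "tyof \<Gamma> l = Some (R \<rightarrow>\<^sub>t NatT)"
    and n_type [simp]: "tyof \<Gamma> n = Some NatT"
    and e_type [simp]: "tyof \<Gamma> e = Some (NatT \<rightarrow>\<^sub>t J R X)"
    and q_type [simp]: "tyof \<Gamma> q = Some (seqt X \<rightarrow>\<^sub>t R)"
    and epq_in_H: "epq_at X (valt X) f \<in> H"
begin

lemma epq_context_mono: "H \<subseteq> H' \<Longrightarrow> epq_context T \<Gamma> H' X R f l n e q"
  using f_type l_type n_type e_type q_type epq_in_H by unfold_locales blast+

text \<open>The parameters are arbitrary terms, so an argument under a quantifier is another
  instance of the same locale, at the lifted terms.\<close>

lemma epq_context_lift: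
  "lift_fm ` H \<subseteq> H' \<Longrightarrow> epq_context T (\<sigma> # \<Gamma>) H' X R
    (lift_tm f) (lift_tm l) (lift_tm n) (lift_tm e) (lift_tm q)"
  using f_type l_type n_type e_type q_type imageI[OF epq_in_H, of lift_fm]
  by unfold_locales (auto simp del: f_type l_type n_type e_type q_type)

lemma epq_stop:
  assumes "tc L = Some (valt X \<rightarrow>\<^sub>t NatT)" "tc N = Some NatT" "tc P = Some (NatT \<rightarrow>\<^sub>t K (valt X) X)"
    "tc Q = Some (seqt X \<rightarrow>\<^sub>t valt X)"
    and "cls less_tm \<bullet> (L \<bullet> (Q \<bullet> cls (zero (seqt X)))) \<bullet> N = cls (Const TrueC)"
  shows "cls f \<bullet> L \<bullet> N \<bullet> P \<bullet> Q = Q \<bullet> cls (zero (seqt X))"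
  unfolding epq_eq[OF epq_in_H f_type assms(1-4)] assms(5) using assms(1-4) by simp

lemma epq_go:
  assumes "tc L = Some (valt X \<rightarrow>\<^sub>t NatT)" "tc N = Some NatT" "tc P = Some (NatT \<rightarrow>\<^sub>t K (valt X) X)"
    "tc Q = Some (seqt X \<rightarrow>\<^sub>t valt X)"
    and "cls less_tm \<bullet> (L \<bullet> (Q \<bullet> cls (zero (seqt X)))) \<bullet> N = cls (Const FalseC)"
  shows "cls f \<bullet> L \<bullet> N \<bullet> P \<bullet> Q = P \<bullet> N \<bullet> (cls (next_values X (valt X)) \<bullet> cls f \<bullet> L \<bullet> N \<bullet> P \<bullet> Q)"
  unfolding epq_eq[OF epq_in_H f_type assms(1-4)] assms(5) using assms(1-4) by simp

text \<open>The left side tests l(q(x * s * 0)) and the right side l(q_x(s * 0)) against the same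
  position. These tests agree, so both sides stop, with the play x * s * 0.\<close>

lemma left_eq_right_secured:
  assumes "tc Y = Some X" "tc S = Some (SeqT X)"
    and "cls (secured X R) \<bullet> cls l \<bullet> cls n \<bullet> cls q \<bullet> Y \<bullet> S = cls (Const TrueC)"
  shows "cls (left_side X R) \<bullet> cls f \<bullet> cls l \<bullet> cls n \<bullet> cls e \<bullet> cls q \<bullet> Y \<bullet> S
    = cls (right_side X R) \<bullet> cls f \<bullet> cls l \<bullet> cls n \<bullet> cls e \<bullet> cls q \<bullet> Y \<bullet> S"
  using assms by (simp add: value_left_app epq_stop)

text \<open>Unfolding epq once brings in \<open>tick\<close>, which makes the move alpha(I).
  Appending this move to the segment of length I gives the segment of length I + 1, where the next
  count is taken.\<close>

lemma counter_Succ: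
  assumes "tc Y = Some X" "tc A = Some (seqt X)" "tc I = Some NatT"
    and "cls (secured X R) \<bullet> cls l \<bullet> cls n \<bullet> cls q \<bullet> Y \<bullet> (cls (segment X) \<bullet> A \<bullet> I)
      = cls (Const FalseC)"
  shows "cls (counter X R) \<bullet> cls f \<bullet> cls l \<bullet> cls n \<bullet> cls e \<bullet> cls q \<bullet> Y \<bullet> A \<bullet> I
    = cls (Const SuccC) \<bullet> (cls (counter X R) \<bullet> cls f \<bullet> cls l \<bullet> cls n \<bullet> cls e \<bullet> cls q \<bullet> Y \<bullet> A
        \<bullet> (cls (Const SuccC) \<bullet> I))"
proof -
  let ?S = "cls (segment X) \<bullet> A \<bullet> I"
  note go = epq_go[of "cls (ctrl X R) \<bullet> cls l \<bullet> cls q"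
      "cls (Const (SeqRecC X NatT)) \<bullet> cls n \<bullet> cls (succ_step X) \<bullet> ?S"
      "cls (quant X R) \<bullet> cls e \<bullet> cls q"
      "cls (outcome X) \<bullet> (cls (compose X) \<bullet> (cls (prepend X) \<bullet> Y)
          \<bullet> (cls (Const (SeqRecC X (seqt X \<rightarrow>\<^sub>t seqt X))) \<bullet> cls (ident X) \<bullet> cls (section_step X) \<bullet> ?S))"]
  show ?thesis using assms by (simp add: value_left_app go)
qed

text \<open>Both sides unfold to a selected move followed by a recursive value. By the induction
  hypothesis at every move, the selection function receives the same argument on both sides and
  selects the same move; the hypothesis at that move then equates the values.\<close>

lemma left_eq_right_step:
  assumes [simp]: "tyof \<Gamma> x = Some X" "tyof \<Gamma> s = Some (SeqT X)"
    and unsecured: "cls (secured X R) \<bullet> cls l \<bullet> cls n \<bullet> cls q \<bullet> cls x \<bullet> cls s = cls (Const FalseC)"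
    and IH: "All X (Eq (seqt X)
      (lift_tm (left_side X R \<cdot> f \<cdot> l \<cdot> n \<cdot> e \<cdot> q \<cdot> x) \<cdot> Snoc X (lift_tm s) (Var 0))
      (lift_tm (right_side X R \<cdot> f \<cdot> l \<cdot> n \<cdot> e \<cdot> q \<cdot> x) \<cdot> Snoc X (lift_tm s) (Var 0))) \<in> H"
  shows "cls (left_side X R) \<bullet> cls f \<bullet> cls l \<bullet> cls n \<bullet> cls e \<bullet> cls q \<bullet> cls x \<bullet> cls s
    = cls (right_side X R) \<bullet> cls f \<bullet> cls l \<bullet> cls n \<bullet> cls e \<bullet> cls q \<bullet> cls x \<bullet> cls s"
proof -
  let ?lt = "left_side X R \<cdot> f \<cdot> l \<cdot> n \<cdot> e \<cdot> q \<cdot> x" and ?rt = "right_side X R \<cdot> f \<cdot> l \<cdot> n \<cdot> e \<cdot> q \<cdot> x"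
  let ?qx = "section_at X R \<cdot> q \<cdot> x" and ?n = "position X n s"
  let ?ol = "outcome X \<cdot> (compose X \<cdot> (prepend X \<cdot> x) \<cdot> after X s)" and ?or = "outcome X \<cdot> after X s"
  let ?nl = "next_values X (valt X) \<cdot> f \<cdot> (ctrl X R \<cdot> l \<cdot> q) \<cdot> ?n \<cdot> (quant X R \<cdot> e \<cdot> q) \<cdot> ?ol"
  let ?nr = "next_values X (valt X) \<cdot> f \<cdot> (ctrl X R \<cdot> l \<cdot> ?qx) \<cdot> ?n \<cdot> (quant X R \<cdot> e \<cdot> ?qx) \<cdot> ?or"
  have "cls (tail_value X R \<cdot> q \<cdot> ?nl) = cls (tail_value X R \<cdot> ?qx \<cdot> ?nr)"
  proof (rule cls_ext)
    interpret U: epq_context T "X # \<Gamma>" "lift_fm ` H" X R "lift_tm f" "lift_tm l" "lift_tm n"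
      "lift_tm e" "lift_tm q" by (rule epq_context_lift) simp
    show "U.cls (lift_tm (tail_value X R \<cdot> q \<cdot> ?nl) \<cdot> Var 0)
      = U.cls (lift_tm (tail_value X R \<cdot> ?qx \<cdot> ?nr) \<cdot> Var 0)"
      using imageI[OF IH, of lift_fm] U.cls_All_Snoc[of X "seqt X" "lift_tm ?lt" "lift_tm s" "lift_tm ?rt" "U.cls (Var 0)"]
      by (simp add: U.value_left_app)
  qed simp_all
  then have tails: "cls (tail_value X R) \<bullet> cls q \<bullet> cls ?nl = cls (tail_value X R) \<bullet> cls ?qx \<bullet> cls ?nr"
    by simp
  note go_left = epq_go[of "cls (ctrl X R \<cdot> l \<cdot> q)" "cls ?n" "cls (quant X R \<cdot> e \<cdot> q)" "cls ?ol"]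
  note go_right = epq_go[of "cls (ctrl X R \<cdot> l \<cdot> ?qx)" "cls ?n" "cls (quant X R \<cdot> e \<cdot> ?qx)" "cls ?or"]
  \<comment> \<open>The induction hypothesis at the common selected move.\<close>
  note snoc = cls_All_Snoc[OF IH, of "cls e \<bullet> cls ?n \<bullet> (cls (tail_value X R) \<bullet> cls ?qx \<bullet> cls ?nr)"]
  show ?thesis
    using unsecured tails snoc
    by (simp add: value_left_app go_left[simplified] go_right[simplified])
qed

text \<open>The existence of a secured segment is itself the goal in \<open>decreasing_nat\<close>,
  with the count along \<open>a\<close> as the decreasing function. At each length the segment is
  secured, or the count drops by \<open>counter_Succ\<close>.\<close>

lemma bar_exists:
  assumes [simp]: "tyof \<Gamma> x = Some X" "tyof \<Gamma> a = Some (seqt X)"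
  shows "T; \<Gamma>; H \<turnstile> Ex NatT (Eq BoolT
    (lift_tm (secured X R \<cdot> l \<cdot> n \<cdot> q \<cdot> x) \<cdot> (segment X \<cdot> lift_tm a \<cdot> Var 0)) (Const TrueC))"
    (is "T; \<Gamma>; H \<turnstile> Ex NatT ?\<phi>")
proof (rule decreasing_nat)
  note [simp] = inst_simps
  let ?g = "counter X R \<cdot> f \<cdot> l \<cdot> n \<cdot> e \<cdot> q \<cdot> x \<cdot> a"
  show "tyof \<Gamma> ?g = Some (NatT \<rightarrow>\<^sub>t NatT)" by simp
  show wf: "wf_fm \<Gamma> (Ex NatT ?\<phi>)" by simp
  show "T; \<Gamma>; H \<turnstile> All NatT (Or (lift_fm (Ex NatT ?\<phi>))
      (Eq NatT (lift_tm ?g \<cdot> Var 0) (Succ (lift_tm ?g \<cdot> Succ (Var 0)))))"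
  proof (rule prv.AllI)
    let ?\<Delta> = "NatT # \<Gamma>"
    let ?b = "lift_tm (secured X R \<cdot> l \<cdot> n \<cdot> q \<cdot> x) \<cdot> (segment X \<cdot> lift_tm a \<cdot> Var 0)"
    let ?Ht = "insert (Eq BoolT ?b (Const TrueC)) (lift_fm ` H)"
    \<comment> \<open>An opaque name, since simp would rewrite inside the parameter H of \<open>cls\<close>.\<close>
    define Hf where "Hf = insert (Eq BoolT ?b (Const FalseC)) (lift_fm ` H)"
    interpret U: HA_context T ?\<Delta> "lift_fm ` H" by (rule HA_context_T)
    interpret F: epq_context T ?\<Delta> Hf X R "lift_tm f" "lift_tm l" "lift_tm n" "lift_tm e" "lift_tm q"
      by (rule epq_context_lift) (auto simp: Hf_def)
    show "T; ?\<Delta>; lift_fm ` H \<turnstile> Or (lift_fm (Ex NatT ?\<phi>))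
      (Eq NatT (lift_tm ?g \<cdot> Var 0) (Succ (lift_tm ?g \<cdot> Succ (Var 0))))"
    proof (rule prv.OrE[OF U.bool_cases[of ?b]])
      \<comment> \<open>A secured segment witnesses the claim by its own length, which is variable
        0.\<close>
      have "T; ?\<Delta>; ?Ht \<turnstile> inst_fm 0 (Var 0) (ren_fm (up_ren Suc) ?\<phi>)"
        by (simp add: prv.assm)
      then have "T; ?\<Delta>; ?Ht \<turnstile> lift_fm (Ex NatT ?\<phi>)"
        unfolding ren_fm.simps by (rule prv.ExI) simp_all
      then show "T; ?\<Delta>; ?Ht \<turnstile> Or (lift_fm (Ex NatT ?\<phi>))
          (Eq NatT (lift_tm ?g \<cdot> Var 0) (Succ (lift_tm ?g \<cdot> Succ (Var 0))))"
        by (rule prv.OrI1) simp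
      have "F.cls ?b = F.cls (Const FalseC)"
        by (rule F.cls_assm[where \<tau> = BoolT]) (simp_all add: Hf_def)
      then have "F.cls (lift_tm ?g \<cdot> Var 0) = F.cls (Succ (lift_tm ?g \<cdot> Succ (Var 0)))"
        using F.counter_Succ[of "F.cls (lift_tm x)" "F.cls (lift_tm a)" "F.cls (Var 0)"]
        by (simp del: F.counter_app F.secured_app)
      then have "T; ?\<Delta>; Hf \<turnstile> Eq NatT (lift_tm ?g \<cdot> Var 0) (Succ (lift_tm ?g \<cdot> Succ (Var 0)))"
        by (rule F.cls_eqD(1)) simp
      then show "T; ?\<Delta>; insert (Eq BoolT ?b (Const FalseC)) (lift_fm ` H) \<turnstile> Or (lift_fm (Ex NatT ?\<phi>))
          (Eq NatT (lift_tm ?g \<cdot> Var 0) (Succ (lift_tm ?g \<cdot> Succ (Var 0))))"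
        unfolding Hf_def by (rule prv.OrI2) simp
    qed simp
  qed
qed

lemma left_eq_right:
  assumes BI: "BI \<subseteq> T" and [simp]: "tyof \<Gamma> x = Some X"
  shows "cls (left_side X R \<cdot> f \<cdot> l \<cdot> n \<cdot> e \<cdot> q \<cdot> x \<cdot> Empty X) = cls (right_side X R \<cdot> f \<cdot> l \<cdot> n \<cdot> e \<cdot> q \<cdot> x \<cdot> Empty X)"
proof (rule bar_induction_eq[OF BI, where b = "secured X R \<cdot> l \<cdot> n \<cdot> q \<cdot> x" and \<tau> = "seqt X"])
  let ?b = "secured X R \<cdot> l \<cdot> n \<cdot> q \<cdot> x"
  let ?lt = "left_side X R \<cdot> f \<cdot> l \<cdot> n \<cdot> e \<cdot> q \<cdot> x" and ?rt = "right_side X R \<cdot> f \<cdot> l \<cdot> n \<cdot> e \<cdot> q \<cdot> x"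
  let ?\<Delta> = "SeqT X # \<Gamma>"
  {
    interpret U: epq_context T "seqt X # \<Gamma>" "lift_fm ` H" X R
      "lift_tm f" "lift_tm l" "lift_tm n" "lift_tm e" "lift_tm q"
      by (rule epq_context_lift) simp
    show "T; seqt X # \<Gamma>; lift_fm ` H \<turnstile> Ex NatT
      (Eq BoolT (lift_tm (lift_tm ?b) \<cdot> (segment X \<cdot> Var 1 \<cdot> Var 0)) (Const TrueC))"
      using U.bar_exists[of "lift_tm x" "Var 0"] by simp
  next
    define G where "G = insert (Eq BoolT (lift_tm ?b \<cdot> Var 0) (Const TrueC)) (lift_fm ` H)"
    interpret U: epq_context T ?\<Delta> G X R
      "lift_tm f" "lift_tm l" "lift_tm n" "lift_tm e" "lift_tm q"
      by (rule epq_context_lift) (auto simp: G_def)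
    have "U.cls (lift_tm ?b \<cdot> Var 0) = U.cls (Const TrueC)"
      by (rule U.cls_assm[where \<tau> = BoolT]) (simp_all add: G_def)
    then have "U.cls (lift_tm ?lt \<cdot> Var 0) = U.cls (lift_tm ?rt \<cdot> Var 0)"
      using U.left_eq_right_secured[of "U.cls (lift_tm x)" "U.cls (Var 0)"]
      by (simp del: U.left_side_app U.right_side_app U.secured_app)
    then show "HA_context.cls T ?\<Delta> (insert (Eq BoolT (lift_tm ?b \<cdot> Var 0) (Const TrueC)) (lift_fm ` H))
        (lift_tm ?lt \<cdot> Var 0)
      = HA_context.cls T ?\<Delta> (insert (Eq BoolT (lift_tm ?b \<cdot> Var 0) (Const TrueC)) (lift_fm ` H))
        (lift_tm ?rt \<cdot> Var 0)"
      unfolding G_def .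
  next
    let ?IH = "All X (Eq (seqt X) (lift_tm (lift_tm ?lt) \<cdot> Snoc X (Var 1) (Var 0))
      (lift_tm (lift_tm ?rt) \<cdot> Snoc X (Var 1) (Var 0)))"
    define G where "G = insert (Eq BoolT (lift_tm ?b \<cdot> Var 0) (Const FalseC)) (insert ?IH (lift_fm ` H))"
    interpret U: epq_context T ?\<Delta> G X R
      "lift_tm f" "lift_tm l" "lift_tm n" "lift_tm e" "lift_tm q"
      by (rule epq_context_lift) (auto simp: G_def)
    have "U.cls (lift_tm ?b \<cdot> Var 0) = U.cls (Const FalseC)"
      by (rule U.cls_assm[where \<tau> = BoolT]) (simp_all add: G_def)
    moreover have "?IH \<in> G" by (simp add: G_def)
    ultimately have "U.cls (lift_tm ?lt \<cdot> Var 0) = U.cls (lift_tm ?rt \<cdot> Var 0)"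
      using U.left_eq_right_step[of "lift_tm x" "Var 0"]
      by (simp del: U.left_side_app U.right_side_app U.secured_app)
    then show "HA_context.cls T ?\<Delta> (insert (Eq BoolT (lift_tm ?b \<cdot> Var 0) (Const FalseC))
          (insert ?IH (lift_fm ` H))) (lift_tm ?lt \<cdot> Var 0)
      = HA_context.cls T ?\<Delta> (insert (Eq BoolT (lift_tm ?b \<cdot> Var 0) (Const FalseC))
          (insert ?IH (lift_fm ` H))) (lift_tm ?rt \<cdot> Var 0)"
      unfolding G_def .
  }
qed simp_all

section \<open>The defining equation of eps for the witness\<close>

lemma section_value:
  assumes BI: "BI \<subseteq> T" and "tc Y = Some X"
  shows "cls (fstv X) \<bullet> (cls f \<bullet> (cls (ctrl X R) \<bullet> cls l \<bullet> cls q) \<bullet> cls n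
      \<bullet> (cls (quant X R) \<bullet> cls e \<bullet> cls q) \<bullet> (cls (outcome X) \<bullet> (cls (prepend X) \<bullet> Y)))
    = cls (prepend X) \<bullet> Y \<bullet> (cls (eps_of_epq X R) \<bullet> cls f \<bullet> cls l \<bullet> cls n \<bullet> cls e
        \<bullet> (cls (section_at X R) \<bullet> cls q \<bullet> Y))"
proof -
  from assms(2) obtain x where [simp]: "Y = cls x" "tyof \<Gamma> x = Some X" by (elim tcE)
  \<comment> \<open>At the empty s the position is n and the stored maps are \<open>prepend\<close>
    of x and \<open>ident\<close>, so the right side is x followed by the witness at q_x.\<close>
  show ?thesis using left_eq_right[OF BI, of x] by (simp add: value_left_app)
qed

text \<open>If the stopping test succeeds, the play is the zero sequence. Otherwise epq is unfolded
  once and \<open>section_value\<close> is used twice: for each possible move, to recognise the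
  selected move as \<open>c\<close>, and then at \<open>c\<close>, to recognise the resulting
  play.\<close>

lemma eps_of_epq_eq:
  assumes BI: "BI \<subseteq> T"
  defines "c \<equiv> e \<cdot> n \<cdot> Lam X (section_at X R \<cdot> lift_tm q \<cdot> Var 0 \<cdot>
    (eps_of_epq X R \<cdot> lift_tm f \<cdot> lift_tm l \<cdot> Succ (lift_tm n) \<cdot> lift_tm e
      \<cdot> (section_at X R \<cdot> lift_tm q \<cdot> Var 0)))"
  shows "cls (eps_of_epq X R \<cdot> f \<cdot> l \<cdot> n \<cdot> e \<cdot> q)
    = cls (Cond (seqt X) (less_tm \<cdot> (l \<cdot> (q \<cdot> zero (seqt X))) \<cdot> n) (zero (seqt X))
        (prepend X \<cdot> c \<cdot> (eps_of_epq X R \<cdot> f \<cdot> l \<cdot> Succ n \<cdot> e \<cdot> (section_at X R \<cdot> q \<cdot> c))))"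
proof -
  let ?b = "less_tm \<cdot> (l \<cdot> (q \<cdot> zero (seqt X))) \<cdot> n"
  have c_type [simp]: "tyof \<Gamma> c = Some X" by (simp add: c_def)
  show ?thesis
  proof (rule cls_bool_cases[where b = ?b and \<tau> = "seqt X"])
    let ?H = "insert (Eq BoolT ?b (Const TrueC)) H"
    interpret U: epq_context T \<Gamma> ?H X R f l n e q by (rule epq_context_mono) auto
    have "U.cls ?b = U.cls (Const TrueC)"
      by (rule U.cls_assm[where \<tau> = BoolT]) simp_all
    then show "U.cls (eps_of_epq X R \<cdot> f \<cdot> l \<cdot> n \<cdot> e \<cdot> q)
      = U.cls (Cond (seqt X) ?b (zero (seqt X))
        (prepend X \<cdot> c \<cdot> (eps_of_epq X R \<cdot> f \<cdot> l \<cdot> Succ n \<cdot> e \<cdot> (section_at X R \<cdot> q \<cdot> c))))"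
      by (simp add: U.epq_stop del: U.eps_of_epq_app) (simp add: U.epq_stop)
  next
    define G where "G = insert (Eq BoolT ?b (Const FalseC)) H"
    interpret U: epq_context T \<Gamma> G X R f l n e q by (rule epq_context_mono) (auto simp: G_def)
    \<comment> \<open>The recursive calls take place one position later, hence
      \<open>Succ n\<close>. \<open>S\<close> serves the selected move \<open>c\<close>, and
      \<open>W\<close> a fresh variable standing for an arbitrary move.\<close>
    interpret S: epq_context T \<Gamma> G X R f l "Succ n" e q
      by unfold_locales (auto simp: U.epq_in_H)
    interpret W: epq_context T "X # \<Gamma>" "lift_fm ` G" X R
      "lift_tm f" "lift_tm l" "lift_tm (Succ n)" "lift_tm e" "lift_tm q"
      by (rule S.epq_context_lift) simp
    let ?body = "section_at X R \<cdot> lift_tm q \<cdot> Var 0 \<cdot>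
      (eps_of_epq X R \<cdot> lift_tm f \<cdot> lift_tm l \<cdot> Succ (lift_tm n) \<cdot> lift_tm e
        \<cdot> (section_at X R \<cdot> lift_tm q \<cdot> Var 0))"
    let ?next = "next_values X (valt X) \<cdot> f \<cdot> (ctrl X R \<cdot> l \<cdot> q) \<cdot> n \<cdot> (quant X R \<cdot> e \<cdot> q)
      \<cdot> (outcome X \<cdot> ident X)"
    \<comment> \<open>The function that \<open>quant\<close> hands to the selection function is, by
      extensionality, the abstraction inside \<open>c\<close>.\<close>
    have "U.cls (tail_value X R \<cdot> q \<cdot> ?next) = U.cls (Lam X ?body)"
    proof (rule U.cls_ext)
      show "W.cls (lift_tm (tail_value X R \<cdot> q \<cdot> ?next) \<cdot> Var 0) = W.cls (lift_tm (Lam X ?body) \<cdot> Var 0)"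
        using W.section_value[OF BI, of "W.cls (Var 0)"] by simp
    qed simp_all
    then have choice: "U.cls (e \<cdot> n \<cdot> (tail_value X R \<cdot> q \<cdot> ?next)) = U.cls c"
      by (simp add: c_def)
    have b: "U.cls ?b = U.cls (Const FalseC)"
      by (rule U.cls_assm[where \<tau> = BoolT]) (simp_all add: G_def)
    note go = U.epq_go[of "U.cls (ctrl X R \<cdot> l \<cdot> q)" "U.cls n" "U.cls (quant X R \<cdot> e \<cdot> q)"
        "U.cls (outcome X \<cdot> ident X)"]
    have "U.cls (eps_of_epq X R \<cdot> f \<cdot> l \<cdot> n \<cdot> e \<cdot> q)
      = U.cls (Cond (seqt X) ?b (zero (seqt X))
        (prepend X \<cdot> c \<cdot> (eps_of_epq X R \<cdot> f \<cdot> l \<cdot> Succ n \<cdot> e \<cdot> (section_at X R \<cdot> q \<cdot> c))))"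
      using b choice S.section_value[OF BI, of "U.cls c"] by (simp add: go[simplified])
    then show "HA_context.cls T \<Gamma> (insert (Eq BoolT ?b (Const FalseC)) H)
        (eps_of_epq X R \<cdot> f \<cdot> l \<cdot> n \<cdot> e \<cdot> q)
      = HA_context.cls T \<Gamma> (insert (Eq BoolT ?b (Const FalseC)) H)
        (Cond (seqt X) ?b (zero (seqt X))
          (prepend X \<cdot> c \<cdot> (eps_of_epq X R \<cdot> f \<cdot> l \<cdot> Succ n \<cdot> e \<cdot> (section_at X R \<cdot> q \<cdot> c))))"
      unfolding G_def .
  qed simp_all
qed

end

lemma epq_equation_eq: "epq_equation X R = epq_at X R (Var 0)"
  by (simp add: epq_at_def epq_equation_def Let_def up_sub_scons numeral_eq_Suc)

theorem theorem3p7: "T_definable (HA_omega \<union> BI) epq eps"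
  unfolding T_definable_def
proof (intro allI exI conjI)
  fix XR :: "ty \<times> ty"
  let ?X = "fst XR" and ?R = "snd XR"
  let ?p = "(?X, valt ?X)" and ?T = "HA_omega \<union> BI"
  show "[] \<turnstile>\<^sub>t eps_of_epq ?X ?R : ftype epq ?p \<rightarrow>\<^sub>t ftype eps XR"
    by (simp add: has_type_iff epq_def eps_def case_prod_beta)
  \<comment> \<open>The context once the four quantifiers of the equation of eps are introduced. The
    given solution of epq has become variable 4, and its assumed equation has been lifted
    accordingly.\<close>
  let ?\<Gamma> = "[seqt ?X \<rightarrow>\<^sub>t ?R, NatT \<rightarrow>\<^sub>t J ?R ?X, NatT, ?R \<rightarrow>\<^sub>t NatT, epq_type ?X (valt ?X)]"
  let ?H = "{epq_at ?X (valt ?X) (Var 4)}"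
  interpret epq_context ?T ?\<Gamma> ?H ?X ?R "Var 4" "Var 3" "Var 2" "Var 1" "Var 0"
    by unfold_locales simp_all
  from cls_eqD(1)[OF eps_of_epq_eq, of "seqt ?X"]
  show "?T; [ftype epq ?p]; {equation epq ?p} \<turnstile> inst_fm 1 (eps_of_epq ?X ?R \<cdot> Var 0) (equation eps XR)"
    by (auto simp: epq_def eps_def case_prod_beta inst_simps eps_equation_def Let_def
        epq_equation_eq numeral_eq_Suc intro!: prv.AllI)
qed

end
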